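(* Let $\Omega\subset\mathbb{R}^N$ be a bounded Lipschitz domain and let $0<s<1$. Let $p\in C(\overline{\Omega}\times\overline{\Omega})$ be symmetric, i.e. $p(x,y)=p(y,x)$ for all $x,y\in\overline{\Omega}$, with $1<p^-:=\inf_{\overline{\Omega}\times\overline{\Omega}}p\le p^+:=\sup_{\overline{\Omega}\times\overline{\Omega}}p<\infty$, and let $q\in C_+(\overline{\Omega})$. Assume furthermore that $$sp^+<N\quad\text{and}\quad q(x)\ge p(x,x)\ \text{ for all }x\in\overline{\Omega}.$$ Then for every $r\in C_+(\overline{\Omega})$ such that $$r(x)<p_s^*(x):=\frac{Np(x,x)}{N-sp(x,x)}\quad\text{for all }x\in\overline{\Omega},$$ the space $W^{s,q(\cdot),p(\cdot,\cdot)}(\Omega)$ is compactly imbedded in $L^{r(\cdot)}(\Omega)$, i.e. $W^{s,q(\cdot),p(\cdot,\cdot)}(\Omega)\subset L^{r(\cdot)}(\Omega)$ and the inclusion map is a compact continuous linear operator.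
   Context: $C_+(\overline{\Omega})$ is the set of $h\in C(\overline{\Omega})$ with $1<\inf_{\overline{\Omega}}h\le\sup_{\overline{\Omega}}h<\infty$. For $h\in C_+(\overline{\Omega})$, the variable exponent Lebesgue space $L^{h(\cdot)}(\Omega)$ is the set of measurable $u:\Omega\to\mathbb{R}$ with $\int_\Omega|u(x)|^{h(x)}\,dx<\infty$, endowed with the Luxemburg norm $\|u\|_{L^{h(\cdot)}(\Omega)}=\inf\{\lambda>0:\int_\Omega|u(x)/\lambda|^{h(x)}\,dx\le1\}$. The fractional Sobolev space with variable exponents is $$W^{s,q(\cdot),p(\cdot,\cdot)}(\Omega):=\Big\{u\in L^{q(\cdot)}(\Omega):\int_\Omega\int_\Omega\frac{|u(x)-u(y)|^{p(x,y)}}{|x-y|^{N+sp(x,y)}}\,dx\,dy<\infty\Big\},$$ endowed with the norm $\|u\|_{s,q,p,\Omega}:=\|u\|_{L^{q(\cdot)}(\Omega)}+[u]_{s,p(\cdot,\cdot),\Omega}$, where $$[u]_{s,p(\cdot,\cdot),\Omega}:=\inf\Big\{\lambda>0:\int_\Omega\int_\Omega\frac{|u(x)-u(y)|^{p(x,y)}}{\lambda^{p(x,y)}|x-y|^{N+sp(x,y)}}\,dx\,dy<1\Big\}.$$ With this norm it is a separable reflexive Banach space. *)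

theory Defs
  imports "HOL-Analysis.Analysis"
begin

text \<open>Near every boundary point the domain is, after a choice of the ``vertical'' unit vector
  \<open>e\<close>, the strict epigraph of a Lipschitz function on the hyperplane orthogonal to \<open>e\<close>.\<close>

definition lipschitz_domain :: "'a::euclidean_space set \<Rightarrow> bool" where
  "lipschitz_domain \<Omega> \<longleftrightarrow>
     open \<Omega> \<and> connected \<Omega> \<and> \<Omega> \<noteq> {} \<and>
     (\<forall>x0\<in>frontier \<Omega>. \<exists>\<rho>>0. \<exists>e (\<gamma> :: 'a \<Rightarrow> real) L.
        norm e = 1 \<and> lipschitz_on L {y. y \<bullet> e = 0} \<gamma> \<and>
        \<Omega> \<inter> ball x0 \<rho> = {y \<in> ball x0 \<rho>. \<gamma> (y - (y \<bullet> e) *\<^sub>R e) < y \<bullet> e})"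

text \<open>For real infima and suprema the boundedness conditions express that they are finite.\<close>

definition C_plus :: "'a::topological_space set \<Rightarrow> ('a \<Rightarrow> real) set" where
  "C_plus K = {h. continuous_on K h \<and> bdd_below (h ` K) \<and> bdd_above (h ` K) \<and> 1 < (INF x\<in>K. h x)}"

text \<open>The spaces below consist of functions, not of classes modulo equality almost everywhere;
  only the values on \<open>\<Omega>\<close> matter, and the ``norms'' vanish exactly on the functions that are
  zero almost everywhere in \<open>\<Omega>\<close>.\<close>

definition lebesgue_space :: "'a::euclidean_space set \<Rightarrow> ('a \<Rightarrow> real) \<Rightarrow> ('a \<Rightarrow> real) set" where
  "lebesgue_space \<Omega> h = {u \<in> borel_measurable (lebesgue_on \<Omega>).
     (\<integral>\<^sup>+ x. ennreal (\<bar>u x\<bar> powr h x) \<partial>lebesgue_on \<Omega>) < \<infinity>}"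

definition luxemburg_norm :: "'a::euclidean_space set \<Rightarrow> ('a \<Rightarrow> real) \<Rightarrow> ('a \<Rightarrow> real) \<Rightarrow> real" where
  "luxemburg_norm \<Omega> h u =
     Inf {l. 0 < l \<and> (\<integral>\<^sup>+ x. ennreal (\<bar>u x / l\<bar> powr h x) \<partial>lebesgue_on \<Omega>) \<le> 1}"

text \<open>On the null set \<open>x = y\<close> the integrand is \<open>0 / 0 = 0\<close>.\<close>

definition gagliardo_modular ::
    "'a::euclidean_space set \<Rightarrow> real \<Rightarrow> ('a \<times> 'a \<Rightarrow> real) \<Rightarrow> real \<Rightarrow> ('a \<Rightarrow> real) \<Rightarrow> ennreal" where
  "gagliardo_modular \<Omega> s p l u =
     (\<integral>\<^sup>+ y. (\<integral>\<^sup>+ x.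
        ennreal (\<bar>u x - u y\<bar> powr p (x, y) /
          (l powr p (x, y) * norm (x - y) powr (real DIM('a) + s * p (x, y))))
        \<partial>lebesgue_on \<Omega>) \<partial>lebesgue_on \<Omega>)"

definition gagliardo_seminorm ::
    "'a::euclidean_space set \<Rightarrow> real \<Rightarrow> ('a \<times> 'a \<Rightarrow> real) \<Rightarrow> ('a \<Rightarrow> real) \<Rightarrow> real" where
  "gagliardo_seminorm \<Omega> s p u = Inf {l. 0 < l \<and> gagliardo_modular \<Omega> s p l u < 1}"

definition fractional_sobolev_space ::
    "'a::euclidean_space set \<Rightarrow> real \<Rightarrow> ('a \<Rightarrow> real) \<Rightarrow> ('a \<times> 'a \<Rightarrow> real) \<Rightarrow> ('a \<Rightarrow> real) set" where
  "fractional_sobolev_space \<Omega> s q p =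
     {u \<in> lebesgue_space \<Omega> q. gagliardo_modular \<Omega> s p 1 u < \<infinity>}"

definition fractional_sobolev_norm ::
    "'a::euclidean_space set \<Rightarrow> real \<Rightarrow> ('a \<Rightarrow> real) \<Rightarrow> ('a \<times> 'a \<Rightarrow> real) \<Rightarrow> ('a \<Rightarrow> real) \<Rightarrow> real" where
  "fractional_sobolev_norm \<Omega> s q p u = luxemburg_norm \<Omega> q u + gagliardo_seminorm \<Omega> s p u"

text \<open>Operators between function spaces \<open>V\<close>, \<open>W\<close> normed by \<open>nV\<close>, \<open>nW\<close>. The clauses say that
  \<open>T\<close> maps \<open>V\<close> into \<open>W\<close>, is linear, is continuous, and maps every bounded sequence to one that
  has a subsequence converging in \<open>W\<close>.\<close>

definition compact_linear_operator ::
    "('a \<Rightarrow> real) set \<Rightarrow> (('a \<Rightarrow> real) \<Rightarrow> real) \<Rightarrow> ('b \<Rightarrow> real) set \<Rightarrow> (('b \<Rightarrow> real) \<Rightarrow> real) \<Rightarrow>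
     (('a \<Rightarrow> real) \<Rightarrow> ('b \<Rightarrow> real)) \<Rightarrow> bool" where
  "compact_linear_operator V nV W nW T \<longleftrightarrow>
     T ` V \<subseteq> W \<and>
     (\<forall>u\<in>V. \<forall>v\<in>V. \<forall>a b. T (\<lambda>x. a * u x + b * v x) = (\<lambda>x. a * T u x + b * T v x)) \<and>
     (\<forall>u\<in>V. \<forall>\<epsilon>>0. \<exists>\<delta>>0. \<forall>v\<in>V.
        nV (\<lambda>x. v x - u x) < \<delta> \<longrightarrow> nW (\<lambda>x. T v x - T u x) < \<epsilon>) \<and>
     (\<forall>f :: nat \<Rightarrow> 'a \<Rightarrow> real. (\<forall>n. f n \<in> V) \<and> (\<exists>C. \<forall>n. nV (f n) \<le> C) \<longrightarrow>
        (\<exists>k :: nat \<Rightarrow> nat. \<exists>w\<in>W. strict_mono k \<and>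
           (\<lambda>n. nW (\<lambda>x. T (f (k n)) x - w x)) \<longlonglongrightarrow> 0))"

definition compactly_imbedded ::
    "('a \<Rightarrow> real) set \<Rightarrow> (('a \<Rightarrow> real) \<Rightarrow> real) \<Rightarrow> ('a \<Rightarrow> real) set \<Rightarrow> (('a \<Rightarrow> real) \<Rightarrow> real) \<Rightarrow> bool" where
  "compactly_imbedded V nV W nW \<longleftrightarrow> V \<subseteq> W \<and> compact_linear_operator V nV W nW (\<lambda>u. u)"

end

theory Submission
  imports Defs "HOL-Complex_Analysis.Great_Picard"
begin

text \<open>
  Let \<open>N\<close> be the dimension and \<open>U x\<close> the Gagliardo potential of \<open>u\<close> at \<open>x\<close>, that is, the integral of the
  Gagliardo quotient of \<open>u\<close> over its other variable. The integral of \<open>U\<close> is the Gagliardo modular, so \<open>U\<close> is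
  bounded in \<open>L\<^sup>1\<close> as long as the modular is bounded. The theorem rests on two consequences of this bound.

  \<^bold>\<open>Gain of integrability.\<close> A Lipschitz domain has measure density: near each point \<open>x0\<close> of its closure, the
  set \<open>\<Omega> \<inter> ball x \<rho>\<close> has measure at least \<open>c * \<rho> ^ N\<close>. Averaging over this set yields a point \<open>y\<close> of it at
  which both \<open>\<bar>u y\<bar> powr m\<close> and the quotient between \<open>x\<close> and \<open>y\<close> are at most a multiple of their means. Hence
  \<open>\<bar>u x\<bar> \<le> A * \<rho> powr (- N / m) + B * \<rho> powr s * (1 + U x) powr (1 / p0)\<close> for all small \<open>\<rho>\<close>, where \<open>p0 \<le> p\<close>
  near \<open>x0\<close> and \<open>A\<close> depends on a bound of \<open>u\<close> in \<open>L\<close> with exponent \<open>m\<close> (\<open>pointwise_bound\<close>). The best choice of \<open>\<rho>\<close>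
  turns local integrability with exponent \<open>m\<close> into local integrability with exponent
  \<open>p0 * (1 + s * m / N)\<close> (\<open>pointwise_gain\<close>, \<open>integral_gain\<close>). This map of exponents is an affine contraction,
  and its fixed point is the critical exponent \<open>N * p0 / (N - s * p0)\<close>. Iteration from \<open>m = 1\<close> therefore
  reaches every subcritical exponent after finitely many steps. A step uses only a local lower bound of \<open>p\<close>,
  and \<open>p0\<close> may be taken close to \<open>p (x0, x0)\<close>, so a finite cover of the closure gives a bound with exponent
  \<open>r + \<delta>\<close> for some \<open>\<delta> > 0\<close> (\<open>higher_integrability\<close>).

  \<^bold>\<open>Almost everywhere convergence.\<close> If \<open>x\<close> lies in a ball of radius \<open>h\<close> inside \<open>\<Omega>\<close>, then \<open>u x\<close> differs from the mean
  of \<open>u\<close> over that ball by at most \<open>(2 * h) powr s * (1 + C * U x)\<close> (\<open>ball_mean_oscillation\<close>). Along a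
  subsequence, the means over a countable family of balls converge. The family covers \<open>\<Omega>\<close> at every
  scale, so the subsequence is Cauchy in \<open>L\<^sup>1\<close>, and a further one converges almost everywhere
  (\<open>modular_ball_AE_Cauchy_subsequence\<close>).

  The bound with exponent \<open>r + \<delta>\<close> makes the powers with exponent \<open>r\<close> uniformly integrable, so by Vitali's
  argument (\<open>vitali_modular_convergence\<close>) almost everywhere convergence becomes convergence of the modular
  with exponent \<open>r\<close>, hence of the Luxemburg norm. Continuity of the inclusion follows from the same bound
  by scaling.
\<close>

section \<open>Gagliardo quotients and potentials\<close>

definition gagliardo_quotient ::
    "real \<Rightarrow> ('a::euclidean_space \<times> 'a \<Rightarrow> real) \<Rightarrow> ('a \<Rightarrow> real) \<Rightarrow> 'a \<Rightarrow> 'a \<Rightarrow> real" where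
  "gagliardo_quotient s p u x y =
     \<bar>u x - u y\<bar> powr p (x, y) / norm (x - y) powr (real DIM('a) + s * p (x, y))"

definition gagliardo_potential ::
    "'a::euclidean_space set \<Rightarrow> real \<Rightarrow> ('a \<times> 'a \<Rightarrow> real) \<Rightarrow> ('a \<Rightarrow> real) \<Rightarrow> 'a \<Rightarrow> ennreal" where
  "gagliardo_potential \<Omega> s p u y =
     (\<integral>\<^sup>+ x. ennreal (gagliardo_quotient s p u x y) \<partial>lebesgue_on \<Omega>)"

lemma gagliardo_quotient_nonneg: "0 \<le> gagliardo_quotient s p u x y"
  by (simp add: gagliardo_quotient_def)

lemma gagliardo_modular_one:
  "gagliardo_modular \<Omega> s p 1 u = (\<integral>\<^sup>+ y. gagliardo_potential \<Omega> s p u y \<partial>lebesgue_on \<Omega>)"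
  by (simp add: gagliardo_modular_def gagliardo_potential_def gagliardo_quotient_def)

text \<open>This reduces every statement about the seminorm to the modular with parameter 1.\<close>

lemma gagliardo_modular_scale:
  assumes "0 < l"
  shows "gagliardo_modular \<Omega> s p l u = gagliardo_modular \<Omega> s p 1 (\<lambda>x. u x / l)"
proof -
  have "\<bar>u x / l - u y / l\<bar> powr e = \<bar>u x - u y\<bar> powr e / l powr e" for x y e
    using assms by (simp add: powr_divide flip: diff_divide_distrib)
  then show ?thesis by (simp add: gagliardo_modular_def)
qed

section \<open>Elementary inequalities\<close>

lemma powr_le_one_plus:
  assumes "0 \<le> (z::real)" "0 \<le> a" "a \<le> b"
  shows "z powr a \<le> 1 + z powr b"
proof (cases "z \<le> 1")
  case True
  then have "z powr a \<le> 1 powr a" using assms by (intro powr_mono2) auto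
  then show ?thesis by (simp add: add_increasing2)
next
  case False
  then have "z powr a \<le> z powr b" using assms by (intro powr_mono) auto
  then show ?thesis by simp
qed

lemma powr_le_cutoff_plus:
  assumes "0 \<le> (z::real)" "1 \<le> T" "0 \<le> \<delta>" "0 \<le> e"
  shows "z powr e \<le> min z T powr e + T powr (- \<delta>) * z powr (e + \<delta>)"
proof (cases "z \<le> T")
  case False
  have "z powr e = z powr (- \<delta>) * z powr (e + \<delta>)" using False assms by (simp flip: powr_add)
  also have "\<dots> \<le> T powr (- \<delta>) * z powr (e + \<delta>)"
    using False assms by (intro mult_right_mono powr_mono2') auto
  finally show ?thesis by (simp add: add_increasing)
qed (simp add: min_absorb1)

lemma abs_diff_powr_le:
  assumes "1 \<le> e" "e \<le> E"
  shows "\<bar>a - b :: real\<bar> powr e \<le> 2 powr E * (\<bar>a\<bar> powr e + \<bar>b\<bar> powr e)"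
proof -
  have "\<bar>a - b\<bar> powr e \<le> (2 * max \<bar>a\<bar> \<bar>b\<bar>) powr e" using assms by (intro powr_mono2) auto
  also have "\<dots> = 2 powr e * max \<bar>a\<bar> \<bar>b\<bar> powr e" by (simp add: powr_mult)
  also have "\<dots> \<le> 2 powr E * (\<bar>a\<bar> powr e + \<bar>b\<bar> powr e)"
    using assms by (intro mult_mono powr_mono) (auto simp: max_def)
  finally show ?thesis .
qed

lemma scaled_powr_le:
  assumes "0 \<le> (\<theta>::real)" "\<theta> \<le> 1" "1 \<le> e"
  shows "\<bar>\<theta> * z\<bar> powr e \<le> \<theta> * \<bar>z\<bar> powr e"
proof -
  have "\<theta> powr e \<le> \<theta> powr 1" using assms by (intro powr_mono') auto
  then have "\<theta> powr e * \<bar>z\<bar> powr e \<le> \<theta> * \<bar>z\<bar> powr e"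
    using assms by (intro mult_right_mono) auto
  then show ?thesis using assms by (simp add: abs_mult powr_mult)
qed

lemma dilated_powr_le:
  assumes "1 \<le> (l::real)" "0 \<le> e" "e \<le> E"
  shows "\<bar>l * z\<bar> powr e \<le> l powr E * \<bar>z\<bar> powr e"
proof -
  have "l powr e * \<bar>z\<bar> powr e \<le> l powr E * \<bar>z\<bar> powr e"
    using assms by (intro mult_right_mono powr_mono) auto
  then show ?thesis using assms by (simp add: abs_mult powr_mult)
qed

section \<open>Measure density of Lipschitz domains\<close>

text \<open>Near a boundary point, let \<open>e\<close> be the direction in which the domain is an epigraph. Going from \<open>x\<close> the
  distance \<open>\<rho> / 2\<close> along \<open>e\<close> gains height \<open>\<rho> / 2\<close> over the graph, and a perturbation of size \<open>\<kappa> * \<rho>\<close>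
  loses at most \<open>(L + 1) * \<kappa> * \<rho>\<close> of it. Hence a ball of radius \<open>\<kappa> * \<rho>\<close> fits into \<open>\<Omega> \<inter> ball x \<rho>\<close>.\<close>

lemma lipschitz_domain_measure_density:
  fixes \<Omega> :: "'a::euclidean_space set"
  assumes "lipschitz_domain \<Omega>" and "x0 \<in> closure \<Omega>"
  obtains c \<rho>0 where "0 < c" "0 < \<rho>0"
    "\<And>x \<rho>. x \<in> \<Omega> \<inter> ball x0 \<rho>0 \<Longrightarrow> 0 < \<rho> \<Longrightarrow> \<rho> \<le> \<rho>0 \<Longrightarrow>
       c * \<rho> ^ DIM('a) \<le> measure lebesgue (\<Omega> \<inter> ball x \<rho>)"
proof -
  have op: "open \<Omega>" using assms by (simp add: lipschitz_domain_def)
  have meas: "\<kappa> ^ DIM('a) * measure lborel (ball (0::'a) 1) * \<rho> ^ DIM('a)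
      \<le> measure lebesgue (\<Omega> \<inter> ball x \<rho>)"
    if "0 < \<rho>" "0 < \<kappa>" "ball z (\<kappa> * \<rho>) \<subseteq> \<Omega> \<inter> ball x \<rho>" for z x :: 'a and \<kappa> \<rho>
  proof -
    have "\<kappa> ^ DIM('a) * measure lborel (ball (0::'a) 1) * \<rho> ^ DIM('a) = measure lebesgue (ball z (\<kappa> * \<rho>))"
      using content_ball_conv_unit_ball[of "\<kappa> * \<rho>" z] that by (simp add: power_mult_distrib)
    also have "\<dots> \<le> measure lebesgue (\<Omega> \<inter> ball x \<rho>)"
      using that op by (intro measure_mono_fmeasurable)
        (auto intro!: bounded_set_imp_lmeasurable simp: bounded_Int open_Int)
    finally show ?thesis .
  qed
  define V where "V = measure lborel (ball (0::'a) 1)"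
  have V: "0 < V" by (simp add: V_def content_ball_pos)
  consider "x0 \<in> \<Omega>" | "x0 \<in> frontier \<Omega>"
    using assms op by (auto simp: frontier_def interior_open)
  then show ?thesis
  proof cases
    case 1
    then obtain b where b: "0 < b" "ball x0 b \<subseteq> \<Omega>" using op open_contains_ball by blast
    show ?thesis
    proof (rule that[of V "b / 2"])
      fix x \<rho> assume x: "x \<in> \<Omega> \<inter> ball x0 (b / 2)" and \<rho>: "0 < \<rho>" "\<rho> \<le> b / 2"
      have "y \<in> ball x0 b" if "dist x y < \<rho>" for y
        using dist_triangle[of x0 y x] that x \<rho> by simp
      then have "ball x \<rho> \<subseteq> \<Omega>" using b by auto
      then show "V * \<rho> ^ DIM('a) \<le> measure lebesgue (\<Omega> \<inter> ball x \<rho>)"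
        using meas[of \<rho> 1 x x] \<rho> by (simp add: V_def)
    qed (use b V in auto)
  next
    case 2
    then obtain b e \<gamma> L where b: "0 < b" and e: "norm e = 1"
      and lip: "lipschitz_on L {y. y \<bullet> e = 0} (\<gamma> :: 'a \<Rightarrow> real)"
      and eq: "\<Omega> \<inter> ball x0 b = {y \<in> ball x0 b. \<gamma> (y - (y \<bullet> e) *\<^sub>R e) < y \<bullet> e}"
      using assms unfolding lipschitz_domain_def by blast
    have L: "0 \<le> L" using lip by (simp add: lipschitz_on_def)
    have ee: "e \<bullet> e = 1" using e by (simp add: norm_eq_1)
    \<comment> \<open>Small enough for both \<open>\<kappa> \<le> 1 / 2\<close> and \<open>(L + 1) * \<kappa> \<le> 1 / 2\<close>, also if \<open>L = 0\<close>.\<close>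
    define \<kappa> where "\<kappa> = 1 / (2 * (L + 2))"
    have \<kappa>: "0 < \<kappa>" "\<kappa> \<le> 1 / 2" "(L + 1) * \<kappa> \<le> 1 / 2"
      using L by (auto simp: \<kappa>_def field_simps)
    show ?thesis
    proof (rule that[of "\<kappa> ^ DIM('a) * V" "b / 2"])
      fix x \<rho> assume x: "x \<in> \<Omega> \<inter> ball x0 (b / 2)" and \<rho>: "0 < \<rho>" "\<rho> \<le> b / 2"
      have "ball (x + (\<rho> / 2) *\<^sub>R e) (\<kappa> * \<rho>) \<subseteq> \<Omega> \<inter> ball x \<rho>"
      proof
        fix y assume "y \<in> ball (x + (\<rho> / 2) *\<^sub>R e) (\<kappa> * \<rho>)"
        define z where "z = y - x - (\<rho> / 2) *\<^sub>R e"
        have z: "norm z < \<kappa> * \<rho>" and y: "y = x + (\<rho> / 2) *\<^sub>R e + z"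
          using \<open>y \<in> _\<close> by (auto simp: z_def dist_norm norm_minus_commute algebra_simps)
        have "dist x y \<le> norm ((\<rho> / 2) *\<^sub>R e) + norm z"
          unfolding y dist_norm using norm_triangle_ineq[of "(\<rho>/2) *\<^sub>R e" z]
          by (metis add.assoc add_diff_cancel_left' norm_minus_commute)
        also have "\<dots> < \<rho> / 2 + \<kappa> * \<rho>" using e z \<rho> by simp
        also have "\<dots> \<le> \<rho>" using mult_right_mono[OF \<kappa>(2), of \<rho>] \<rho> by linarith
        finally have yx: "dist x y < \<rho>" .
        then have yb: "y \<in> ball x0 b"
          using dist_triangle[of x0 y x] x \<rho> by simp
        have zz: "\<bar>z \<bullet> e\<bar> \<le> norm z" using Cauchy_Schwarz_ineq2[of z e] e by simp
        have perp: "norm (z - (z \<bullet> e) *\<^sub>R e) \<le> norm z"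
        proof -
          have "(norm (z - (z \<bullet> e) *\<^sub>R e))\<^sup>2 = (norm z)\<^sup>2 - (z \<bullet> e)\<^sup>2"
            unfolding power2_norm_eq_inner
            by (simp add: inner_diff_left inner_diff_right inner_commute ee) (simp add: power2_eq_square)
          then show ?thesis by (metis diff_ge_0_iff_ge le_add_same_cancel1 norm_ge_zero
              power2_le_imp_le zero_le_power2 diff_add_cancel)
        qed
        have proj: "y - (y \<bullet> e) *\<^sub>R e = (x - (x \<bullet> e) *\<^sub>R e) + (z - (z \<bullet> e) *\<^sub>R e)"
          by (simp add: y inner_add_left ee algebra_simps)
        have "dist (\<gamma> (y - (y \<bullet> e) *\<^sub>R e)) (\<gamma> (x - (x \<bullet> e) *\<^sub>R e))
            \<le> L * dist (y - (y \<bullet> e) *\<^sub>R e) (x - (x \<bullet> e) *\<^sub>R e)"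
          by (intro lipschitz_onD[OF lip]) (auto simp: inner_diff_left ee)
        also have "\<dots> \<le> L * (\<kappa> * \<rho>)"
          unfolding proj dist_norm using perp z L by (intro mult_left_mono) auto
        finally have "\<gamma> (y - (y \<bullet> e) *\<^sub>R e) \<le> \<gamma> (x - (x \<bullet> e) *\<^sub>R e) + L * \<kappa> * \<rho>"
          by (auto simp: dist_real_def)
        also have "\<gamma> (x - (x \<bullet> e) *\<^sub>R e) < x \<bullet> e"
          using x b eq[THEN equalityD1, THEN subsetD, of x] by auto
        also have "x \<bullet> e + L * \<kappa> * \<rho> \<le> x \<bullet> e + \<rho> / 2 - \<kappa> * \<rho>"
          using mult_right_mono[OF \<kappa>(3), of \<rho>] \<rho> by (simp add: distrib_right)
        also have "\<dots> \<le> y \<bullet> e"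
          using zz z by (simp add: y inner_add_left ee)
        finally have "\<gamma> (y - (y \<bullet> e) *\<^sub>R e) < y \<bullet> e" by simp
        then show "y \<in> \<Omega> \<inter> ball x \<rho>" using yb yx eq[THEN equalityD2, THEN subsetD, of y] by auto
      qed
      then show "\<kappa> ^ DIM('a) * V * \<rho> ^ DIM('a) \<le> measure lebesgue (\<Omega> \<inter> ball x \<rho>)"
        using meas[of \<rho> \<kappa>] \<kappa> \<rho> by (simp add: V_def)
    qed (use b V \<kappa> in auto)
  qed
qed

section \<open>Setting and measurability\<close>

text \<open>In the application, \<open>P\<close>, \<open>\<sigma>\<close> and \<open>Q\<close> are the supremum of \<open>p\<close> and the infimum and supremum of \<open>q\<close>.\<close>

locale fractional_setting =
  fixes \<Omega> :: "'a::euclidean_space set" and s :: real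
    and p :: "'a \<times> 'a \<Rightarrow> real" and P :: real
    and q :: "'a \<Rightarrow> real" and \<sigma> Q :: real
  assumes open_domain: "open \<Omega>" and bounded_domain: "bounded \<Omega>" and s_pos: "0 < s"
    and p_continuous: "continuous_on (closure \<Omega> \<times> closure \<Omega>) p"
    and p_bounds: "\<And>x y. x \<in> closure \<Omega> \<Longrightarrow> y \<in> closure \<Omega> \<Longrightarrow> 1 \<le> p (x, y) \<and> p (x, y) \<le> P"
    and q_continuous: "continuous_on (closure \<Omega>) q"
    and sigma_gt_1: "1 < \<sigma>"
    and q_bounds: "\<And>x. x \<in> closure \<Omega> \<Longrightarrow> \<sigma> \<le> q x \<and> q x \<le> Q"
begin

abbreviation "leb \<equiv> lebesgue_on \<Omega>"

lemma domain_lmeasurable: "\<Omega> \<in> lmeasurable"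
  using open_domain bounded_domain by (simp add: lmeasurable_open)

sublocale leb: finite_measure leb
  by (rule finite_measure_lebesgue_on[OF domain_lmeasurable])

lemma in_closure: "x \<in> \<Omega> \<Longrightarrow> x \<in> closure \<Omega>"
  using closure_subset by auto

lemma borel_imp_leb: "f \<in> borel_measurable borel \<Longrightarrow> f \<in> borel_measurable leb"
  by (simp add: measurable_completion measurable_restrict_space1)

lemma open_in_sets_leb: "open A \<Longrightarrow> A \<subseteq> \<Omega> \<Longrightarrow> A \<in> sets leb"
  using open_domain by (auto simp: sets_restrict_space_iff)

lemma emeasure_leb: "A \<in> sets leb \<Longrightarrow> emeasure leb A = emeasure lebesgue A"
  using open_domain by (intro emeasure_restrict_space) (auto simp: sets_restrict_space)

lemma continuous_imp_measurable:
  assumes "continuous_on (closure \<Omega>) h"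
  shows "(h :: 'a \<Rightarrow> real) \<in> borel_measurable leb"
proof -
  have "(\<lambda>x. if x \<in> closure \<Omega> then h x else 0) \<in> borel_measurable borel"
    using assms by (intro borel_measurable_continuous_on_if) auto
  then have "(\<lambda>x. if x \<in> closure \<Omega> then h x else 0) \<in> borel_measurable leb"
    by (rule borel_imp_leb)
  then show ?thesis
    by (rule measurable_cong[THEN iffD1, rotated]) (auto simp: in_closure)
qed

text \<open>The exponent \<open>p\<close> is known only on the closure, so it is first extended by 0 to a Borel function on the whole
  product space.\<close>

lemma quotient_measurable_pair:
  assumes [measurable]: "u \<in> borel_measurable leb"
  shows "(\<lambda>(y, x). gagliardo_quotient s p u x y) \<in> borel_measurable (leb \<Otimes>\<^sub>M leb)"
proof -
  have [measurable]: "(\<lambda>z. z) \<in> leb \<rightarrow>\<^sub>M borel" by (intro borel_imp_leb) auto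
  define p' where "p' = (\<lambda>z. if z \<in> closure \<Omega> \<times> closure \<Omega> then p z else 0)"
  have [measurable]: "p' \<in> borel_measurable borel"
    unfolding p'_def using p_continuous
    by (intro borel_measurable_continuous_on_if) (auto intro: borel_closed closed_Times)
  have "(\<lambda>(y, x). \<bar>u x - u y\<bar> powr p' (x, y) / norm (x - y) powr (real DIM('a) + s * p' (x, y)))
      \<in> borel_measurable (leb \<Otimes>\<^sub>M leb)"
    by measurable
  then show ?thesis
    by (rule measurable_cong[THEN iffD1, rotated])
      (auto simp: gagliardo_quotient_def p'_def space_pair_measure in_closure)
qed

lemma quotient_measurable:
  assumes "u \<in> borel_measurable leb" "y \<in> \<Omega>"
  shows "(\<lambda>x. gagliardo_quotient s p u x y) \<in> borel_measurable leb"
  using measurable_compose[OF measurable_Pair1'[of y leb leb] quotient_measurable_pair[OF assms(1)]] assms(2)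
  by simp

text \<open>Tonelli's theorem. The measurability is needed to split integrals of sums that contain the potential.\<close>

lemma potential_measurable:
  assumes "u \<in> borel_measurable leb"
  shows "gagliardo_potential \<Omega> s p u \<in> borel_measurable leb"
proof -
  have "(\<lambda>(y, x). ennreal (gagliardo_quotient s p u x y)) \<in> borel_measurable (leb \<Otimes>\<^sub>M leb)"
    using measurable_compose[OF quotient_measurable_pair[OF assms] measurable_ennreal]
    by (simp add: case_prod_unfold)
  from leb.borel_measurable_nn_integral[OF this]
  show ?thesis by (simp add: gagliardo_potential_def[abs_def])
qed

lemma exponent_measurable: "q \<in> borel_measurable leb"
  by (rule continuous_imp_measurable[OF q_continuous])

text \<open>A bound of the two modulars instead of the norms: every norm-bounded sequence stays in one of these sets, and
  integral estimates apply to the modulars directly.\<close>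

definition modular_ball :: "real \<Rightarrow> ('a \<Rightarrow> real) set" where
  "modular_ball K = {u \<in> borel_measurable leb.
     (\<integral>\<^sup>+x. ennreal (\<bar>u x\<bar> powr q x) \<partial>leb) \<le> ennreal K \<and> gagliardo_modular \<Omega> s p 1 u \<le> ennreal K}"

lemma modular_ball_mono: "K \<le> K' \<Longrightarrow> modular_ball K \<subseteq> modular_ball K'"
  by (auto simp: modular_ball_def intro: order_trans ennreal_leI)

section \<open>Gain of integrability\<close>

text \<open>Otherwise the integral would be at least \<open>2 * A\<close>. The factor 2 keeps the contradiction strict even
  for constant \<open>f\<close>.\<close>

lemma exists_le_mean:
  assumes E: "E \<in> sets M" and c: "0 < c" "ennreal c \<le> emeasure M E" and "0 < A"
    and int: "(\<integral>\<^sup>+x\<in>E. f x \<partial>M) \<le> ennreal A"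
  shows "\<exists>x\<in>E. f x \<le> ennreal (2 * A / c)"
proof (rule ccontr)
  assume "\<not> ?thesis"
  then have *: "ennreal (2 * A / c) \<le> f x" if "x \<in> E" for x
    using that by (metis linear)
  have "ennreal (2 * A) = ennreal (2 * A / c) * ennreal c"
    using c \<open>0 < A\<close> by (simp flip: ennreal_mult)
  also have "\<dots> \<le> ennreal (2 * A / c) * emeasure M E"
    by (intro mult_left_mono c) auto
  also have "\<dots> = (\<integral>\<^sup>+x\<in>E. ennreal (2 * A / c) \<partial>M)"
    using E by (simp add: nn_integral_cmult_indicator)
  also have "\<dots> \<le> (\<integral>\<^sup>+x\<in>E. f x \<partial>M)"
    using * by (intro nn_integral_mono) (auto simp: indicator_def)
  also have "\<dots> \<le> ennreal A" by (rule int)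
  finally show False using \<open>0 < A\<close> by (simp add: ennreal_le_iff)
qed

text \<open>Averaging \<open>\<bar>u y\<bar> powr m / M\<close> plus the quotient divided by \<open>V\<close> over \<open>\<Omega> \<inter> ball x \<rho>\<close> yields one point \<open>y\<close> where
  the sum is at most a multiple of \<open>\<rho> powr (- DIM('a))\<close>. The first term of the bound controls \<open>\<bar>u y\<bar>\<close> and the second
  \<open>\<bar>u y - u x\<bar>\<close>: the factor \<open>norm (y - x) powr DIM('a)\<close> of the quotient cancels the measure of the ball, which
  leaves \<open>\<rho> powr s\<close>.\<close>

lemma pointwise_bound:
  assumes u: "u \<in> borel_measurable leb" and x: "x \<in> \<Omega>" and \<rho>: "0 < \<rho>"
    and c: "0 < c" "c \<le> 4" "c * \<rho> ^ DIM('a) \<le> measure lebesgue (\<Omega> \<inter> ball x \<rho>)"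
    and p0: "0 < p0" "\<And>y. y \<in> \<Omega> \<inter> ball x \<rho> \<Longrightarrow> p0 \<le> p (y, x)"
    and m: "0 < m"
    and M: "0 < M" "(\<integral>\<^sup>+y\<in>\<Omega> \<inter> ball x \<rho>. ennreal (\<bar>u y\<bar> powr m) \<partial>leb) \<le> ennreal M"
    and V: "1 \<le> V" "gagliardo_potential \<Omega> s p u x \<le> ennreal V"
  shows "\<bar>u x\<bar> \<le> (4 * M / c) powr (1 / m) * \<rho> powr (- real DIM('a) / m)
           + (4 * V / c) powr (1 / p0) * \<rho> powr s"
proof -
  define E where "E = \<Omega> \<inter> ball x \<rho>"
  define g where "g = (\<lambda>y. gagliardo_quotient s p u y x)"
  have g0: "0 \<le> g y" for y by (simp add: g_def gagliardo_quotient_nonneg)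
  have E: "E \<in> sets leb" unfolding E_def using open_domain by (intro open_in_sets_leb) auto
  have [measurable]: "g \<in> borel_measurable leb" "E \<in> sets leb" "u \<in> borel_measurable leb"
    using quotient_measurable[OF u x] E u by (auto simp: g_def)
  have Ef: "E \<in> lmeasurable"
    unfolding E_def using open_domain bounded_domain by (intro lmeasurable_open) (auto simp: bounded_Int)
  have "(\<integral>\<^sup>+y\<in>E. ennreal (\<bar>u y\<bar> powr m / M + g y / V) \<partial>leb)
      = (\<integral>\<^sup>+y. ennreal (1 / M) * (ennreal (\<bar>u y\<bar> powr m) * indicator E y)
          + ennreal (1 / V) * (ennreal (g y) * indicator E y) \<partial>leb)"
    using M V g0
    by (intro nn_integral_cong)
      (auto simp: indicator_def ennreal_mult[symmetric] ennreal_plus[symmetric] simp del: ennreal_plus)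
  also have "\<dots> = ennreal (1 / M) * (\<integral>\<^sup>+y\<in>E. ennreal (\<bar>u y\<bar> powr m) \<partial>leb)
      + ennreal (1 / V) * (\<integral>\<^sup>+y\<in>E. ennreal (g y) \<partial>leb)"
    by (subst nn_integral_add) (auto simp: nn_integral_cmult)
  also have "\<dots> \<le> ennreal (1 / M) * ennreal M + ennreal (1 / V) * ennreal V"
  proof (intro add_mono mult_left_mono)
    have "(\<integral>\<^sup>+y\<in>E. ennreal (g y) \<partial>leb) \<le> gagliardo_potential \<Omega> s p u x"
      unfolding gagliardo_potential_def g_def
      by (intro nn_integral_mono) (auto simp: indicator_def)
    then show "(\<integral>\<^sup>+y\<in>E. ennreal (g y) \<partial>leb) \<le> ennreal V" using V by simp
  qed (use M in \<open>auto simp: E_def\<close>)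
  also have "\<dots> = ennreal 2"
    using M V by (simp add: ennreal_mult[symmetric] ennreal_plus[symmetric] del: ennreal_plus)
  finally have int: "(\<integral>\<^sup>+y\<in>E. ennreal (\<bar>u y\<bar> powr m / M + g y / V) \<partial>leb) \<le> ennreal 2" .
  \<comment> \<open>Twice the integral bound 2, divided by the lower bound of the measure.\<close>
  define B where "B = 4 / (c * \<rho> ^ DIM('a))"
  have B: "0 < B" using c \<rho> by (simp add: B_def)
  have "ennreal (c * \<rho> ^ DIM('a)) \<le> emeasure leb E"
    using c(3) emeasure_leb[OF E] emeasure_eq_measure2[OF Ef] by (simp add: E_def ennreal_leI)
  then obtain y where "y \<in> E" and "ennreal (\<bar>u y\<bar> powr m / M + g y / V) \<le> ennreal B"
    using exists_le_mean[OF E _ _ _ int, of "c * \<rho> ^ DIM('a)"] c \<rho> by (auto simp: B_def)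
  then have yB: "\<bar>u y\<bar> powr m / M + g y / V \<le> B" using B by (simp add: ennreal_le_iff)
  have "\<bar>u y\<bar> powr m / M \<le> B" "g y / V \<le> B"
    using yB g0[of y] M V by (smt (verit) divide_nonneg_pos powr_ge_zero)+
  then have uy: "\<bar>u y\<bar> powr m \<le> M * B" and gy: "g y \<le> V * B"
    using M V by (simp_all add: field_simps)
  have \<rho>N: "\<rho> ^ DIM('a) = \<rho> powr real DIM('a)" using \<rho> by (simp add: powr_realpow)
  have "\<bar>u y\<bar> = (\<bar>u y\<bar> powr m) powr (1 / m)" using m by (simp add: powr_powr)
  also have "\<dots> \<le> (M * B) powr (1 / m)" using uy m by (intro powr_mono2) auto
  also have "M * B = (4 * M / c) * \<rho> powr (- real DIM('a))"
    using \<rho> by (simp add: B_def \<rho>N powr_minus field_simps)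
  also have "\<dots> powr (1 / m) = (4 * M / c) powr (1 / m) * \<rho> powr (- real DIM('a) / m)"
    using M c by (subst powr_mult) (auto simp: powr_powr)
  finally have 1: "\<bar>u y\<bar> \<le> (4 * M / c) powr (1 / m) * \<rho> powr (- real DIM('a) / m)" .
  have 2: "\<bar>u y - u x\<bar> \<le> (4 * V / c) powr (1 / p0) * \<rho> powr s"
  proof (cases "y = x")
    case False
    define e where "e = p (y, x)"
    have e: "p0 \<le> e" "0 < e" using p0 \<open>y \<in> E\<close> by (auto simp: e_def E_def intro: less_le_trans)
    have n: "0 < norm (y - x)" "norm (y - x) \<le> \<rho>"
      using False \<open>y \<in> E\<close> by (auto simp: E_def dist_norm norm_minus_commute)
    have "\<bar>u y - u x\<bar> powr e = g y * norm (y - x) powr (real DIM('a) + s * e)"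
      using n by (simp add: g_def gagliardo_quotient_def e_def)
    also have "\<dots> \<le> (V * B) * \<rho> powr (real DIM('a) + s * e)"
      using gy g0[of y] n s_pos e V B by (intro mult_mono powr_mono2) (auto intro: add_nonneg_nonneg)
    also have "\<dots> = (4 * V / c) * (\<rho> powr s) powr e"
      using \<rho> by (simp add: B_def \<rho>N powr_add powr_powr field_simps)
    finally have le: "\<bar>u y - u x\<bar> powr e \<le> (4 * V / c) * (\<rho> powr s) powr e" .
    have "\<bar>u y - u x\<bar> = (\<bar>u y - u x\<bar> powr e) powr (1 / e)" using e by (simp add: powr_powr)
    also have "\<dots> \<le> ((4 * V / c) * (\<rho> powr s) powr e) powr (1 / e)"
      using le e by (intro powr_mono2) auto
    also have "\<dots> = (4 * V / c) powr (1 / e) * \<rho> powr s"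
      using V c e by (subst powr_mult) (auto simp: powr_powr)
    \<comment> \<open>The base is at least 1 because of \<open>c \<le> 4\<close> and \<open>1 \<le> V\<close>, so the larger exponent gives the larger power.\<close>
    also have "\<dots> \<le> (4 * V / c) powr (1 / p0) * \<rho> powr s"
      using e p0 V c by (intro mult_right_mono powr_mono) (auto simp: field_simps)
    finally show ?thesis .
  qed auto
  show ?thesis using 1 2 by linarith
qed

text \<open>The radius \<open>\<rho>0 * V powr (- a)\<close> balances the two terms of the pointwise bound as powers of \<open>V\<close>.\<close>

lemma pointwise_gain:
  assumes u: "u \<in> borel_measurable leb" and x: "x \<in> \<Omega>" and \<rho>0: "0 < \<rho>0"
    and c: "0 < c" "c \<le> 4"
      "\<And>\<rho>. 0 < \<rho> \<Longrightarrow> \<rho> \<le> \<rho>0 \<Longrightarrow> c * \<rho> ^ DIM('a) \<le> measure lebesgue (\<Omega> \<inter> ball x \<rho>)"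
    and p0: "0 < p0" "\<And>y. y \<in> \<Omega> \<inter> ball x \<rho>0 \<Longrightarrow> p0 \<le> p (y, x)"
    and m: "0 < m"
    and M: "0 < M" "(\<integral>\<^sup>+y\<in>\<Omega> \<inter> ball x \<rho>0. ennreal (\<bar>u y\<bar> powr m) \<partial>leb) \<le> ennreal M"
    and V: "1 \<le> V" "gagliardo_potential \<Omega> s p u x \<le> ennreal V"
  shows "\<bar>u x\<bar> powr (p0 * (1 + s * m / real DIM('a)))
     \<le> ((4 * M / c) powr (1 / m) * \<rho>0 powr (- real DIM('a) / m)
          + (4 / c) powr (1 / p0) * \<rho>0 powr s) powr (p0 * (1 + s * m / real DIM('a))) * V"
    (is "_ powr ?m' \<le> ?A powr _ * V")
proof -
  define N where "N = real DIM('a)"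
  have N: "0 < N" by (simp add: N_def)
  have m': "0 < ?m'" using p0 s_pos m N by (auto simp: N_def intro!: mult_pos_pos add_pos_nonneg)
  \<comment> \<open>The solution of \<open>a * N / m = 1 / p0 - a * s\<close>; both sides are then the reciprocal of the new exponent.\<close>
  define a where "a = m / (p0 * (s * m + N))"
  have pos: "0 < s * m + N" using s_pos m N by (simp add: add_pos_pos)
  have a: "0 < a" using pos p0 m by (simp add: a_def)
  have aN: "a * N / m = 1 / ?m'"
  proof -
    have "?m' = p0 * (s * m + N) / N" using N by (simp add: field_simps flip: N_def)
    then show ?thesis using m by (simp add: a_def)
  qed
  have as: "1 / p0 - a * s = 1 / ?m'"
  proof -
    have "a * s + a * N / m = 1 / p0"
    proof -
      have "a * s + a * N / m = a / m * (s * m + N)" using m by (simp add: field_simps)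
      also have "a / m = 1 / (p0 * (s * m + N))" using m by (simp add: a_def)
      finally show ?thesis using pos by simp
    qed
    then show ?thesis using aN by simp
  qed
  define \<rho> where "\<rho> = \<rho>0 * V powr (- a)"
  have "V powr (- a) \<le> V powr 0" using V a by (intro powr_mono) auto
  then have \<rho>: "0 < \<rho>" "\<rho> \<le> \<rho>0"
    using \<rho>0 V by (auto simp: \<rho>_def mult_le_cancel_left1)
  have "ball x \<rho> \<subseteq> ball x \<rho>0" using \<rho> by auto
  have "\<bar>u x\<bar> \<le> (4 * M / c) powr (1 / m) * \<rho> powr (- real DIM('a) / m)
           + (4 * V / c) powr (1 / p0) * \<rho> powr s"
  proof (rule pointwise_bound[OF u x \<rho>(1) c(1,2) c(3)[OF \<rho>] p0(1) _ m M(1) _ V])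
    show "p0 \<le> p (y, x)" if "y \<in> \<Omega> \<inter> ball x \<rho>" for y
      using p0(2)[of y] that \<open>ball x \<rho> \<subseteq> ball x \<rho>0\<close> by blast
    have "(\<integral>\<^sup>+y\<in>\<Omega> \<inter> ball x \<rho>. ennreal (\<bar>u y\<bar> powr m) \<partial>leb)
        \<le> (\<integral>\<^sup>+y\<in>\<Omega> \<inter> ball x \<rho>0. ennreal (\<bar>u y\<bar> powr m) \<partial>leb)"
      using \<open>ball x \<rho> \<subseteq> ball x \<rho>0\<close> by (intro nn_integral_mono) (auto simp: indicator_def)
    then show "(\<integral>\<^sup>+y\<in>\<Omega> \<inter> ball x \<rho>. ennreal (\<bar>u y\<bar> powr m) \<partial>leb) \<le> ennreal M"
      using M(2) by simp
  qed
  also have "\<rho> powr (- real DIM('a) / m) = \<rho>0 powr (- real DIM('a) / m) * V powr (1 / ?m')"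
    unfolding \<rho>_def using \<rho>0 V
    by (subst powr_mult) (auto simp: powr_powr aN[unfolded N_def])
  also have "(4 * V / c) powr (1 / p0) * \<rho> powr s
      = (4 / c) powr (1 / p0) * \<rho>0 powr s * V powr (1 / ?m')"
  proof -
    have "(4 * V / c) powr (1 / p0) = (4 / c) powr (1 / p0) * V powr (1 / p0)"
      using c V by (subst powr_mult[symmetric]) (auto simp: field_simps)
    moreover have "\<rho> powr s = \<rho>0 powr s * V powr (- a * s)"
      unfolding \<rho>_def using \<rho>0 V by (subst powr_mult) (auto simp: powr_powr)
    moreover have "V powr (1 / p0) * V powr (- a * s) = V powr (1 / ?m')"
      by (simp add: powr_add[symmetric] as[symmetric])
    ultimately show ?thesis by (simp add: mult.assoc mult.left_commute)
  qed
  finally have "\<bar>u x\<bar> \<le> ?A * V powr (1 / ?m')" by (simp add: algebra_simps)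
  then have "\<bar>u x\<bar> powr ?m' \<le> (?A * V powr (1 / ?m')) powr ?m'"
    using m' by (intro powr_mono2) auto
  also have "\<dots> = ?A powr ?m' * V"
    using m' V by (subst powr_mult) (auto simp: powr_powr)
  finally show ?thesis .
qed

text \<open>Integration of the pointwise gain with \<open>V = 1 + U\<close>, where \<open>U\<close> is the potential. The radius is halved because the
  bound at \<open>x\<close> uses \<open>u\<close> in a neighbourhood of \<open>x\<close>.\<close>

lemma integral_gain:
  assumes u: "u \<in> modular_ball K" and K: "0 \<le> K" and \<rho>0: "0 < \<rho>0" "2 * \<rho>0 \<le> b"
    and c: "0 < c" "c \<le> 4"
      "\<And>x \<rho>. x \<in> \<Omega> \<inter> ball x0 \<rho>0 \<Longrightarrow> 0 < \<rho> \<Longrightarrow> \<rho> \<le> \<rho>0 \<Longrightarrow>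
         c * \<rho> ^ DIM('a) \<le> measure lebesgue (\<Omega> \<inter> ball x \<rho>)"
    and p0: "0 < p0" "\<And>x y. x \<in> \<Omega> \<inter> ball x0 b \<Longrightarrow> y \<in> \<Omega> \<inter> ball x0 b \<Longrightarrow> p0 \<le> p (x, y)"
    and m: "0 < m"
    and M: "0 < M" "(\<integral>\<^sup>+y\<in>\<Omega> \<inter> ball x0 b. ennreal (\<bar>u y\<bar> powr m) \<partial>leb) \<le> ennreal M"
  shows "(\<integral>\<^sup>+x\<in>\<Omega> \<inter> ball x0 \<rho>0. ennreal (\<bar>u x\<bar> powr (p0 * (1 + s * m / real DIM('a)))) \<partial>leb)
     \<le> ennreal (((4 * M / c) powr (1 / m) * \<rho>0 powr (- real DIM('a) / m)
          + (4 / c) powr (1 / p0) * \<rho>0 powr s) powr (p0 * (1 + s * m / real DIM('a)))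
        * (measure leb \<Omega> + K))"
    (is "(\<integral>\<^sup>+x\<in>_. ennreal (_ powr ?m') \<partial>leb) \<le> ennreal (?A powr ?m' * _)")
proof -
  let ?U = "gagliardo_potential \<Omega> s p u"
  have u': "u \<in> borel_measurable leb" and UK: "(\<integral>\<^sup>+x. ?U x \<partial>leb) \<le> ennreal K"
    using u by (auto simp: modular_ball_def gagliardo_modular_one)
  have [measurable]: "?U \<in> borel_measurable leb" by (rule potential_measurable[OF u'])
  have A: "0 \<le> ?A powr ?m'" by simp
  have b: "\<rho>0 \<le> b" using \<rho>0 by simp
  have "0 < ?A"
    using M c \<rho>0 by (intro add_pos_pos mult_pos_pos) auto
  have "ennreal (\<bar>u x\<bar> powr ?m') * indicator (\<Omega> \<inter> ball x0 \<rho>0) x \<le> ennreal (?A powr ?m') * (1 + ?U x)"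
    if "x \<in> \<Omega>" for x
  proof (cases "x \<in> ball x0 \<rho>0 \<and> ?U x < \<infinity>")
    case True
    have sub: "ball x \<rho>0 \<subseteq> ball x0 b"
    proof
      fix y assume "y \<in> ball x \<rho>0"
      then show "y \<in> ball x0 b" using dist_triangle[of x0 y x] True \<rho>0 by simp
    qed
    obtain U where U: "?U x = ennreal U" "0 \<le> U"
      using True by (cases "?U x") auto
    have "\<bar>u x\<bar> powr ?m' \<le> ?A powr ?m' * (1 + U)"
    proof (rule pointwise_gain[OF u' that \<rho>0(1) c(1,2) _ p0(1) _ m M(1)])
      show "p0 \<le> p (y, x)" if "y \<in> \<Omega> \<inter> ball x \<rho>0" for y
        using p0(2)[of y x] that sub True \<open>x \<in> \<Omega>\<close> b by auto
      have "(\<integral>\<^sup>+y\<in>\<Omega> \<inter> ball x \<rho>0. ennreal (\<bar>u y\<bar> powr m) \<partial>leb)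
        \<le> (\<integral>\<^sup>+y\<in>\<Omega> \<inter> ball x0 b. ennreal (\<bar>u y\<bar> powr m) \<partial>leb)"
        using sub by (intro nn_integral_mono) (auto simp: indicator_def)
      then show "(\<integral>\<^sup>+y\<in>\<Omega> \<inter> ball x \<rho>0. ennreal (\<bar>u y\<bar> powr m) \<partial>leb) \<le> ennreal M"
        using M(2) by simp
      show "?U x \<le> ennreal (1 + U)" unfolding U by (rule ennreal_leI) simp
    qed (use c(3)[of x] True U that in auto)
    then have "ennreal (\<bar>u x\<bar> powr ?m') \<le> ennreal (?A powr ?m' * (1 + U))"
      by (rule ennreal_leI)
    also have "\<dots> = ennreal (?A powr ?m') * (1 + ?U x)"
      using U by (simp add: ennreal_mult)
    finally show ?thesis by (simp add: indicator_def)
  next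
    case False
    then show ?thesis
    proof (cases "x \<in> ball x0 \<rho>0")
      case True
      with False have "?U x = \<infinity>" by (metis infinity_ennreal_def top.not_eq_extremum)
      then show ?thesis using \<open>0 < ?A\<close> by (simp add: ennreal_mult_top)
    qed auto
  qed
  then have "(\<integral>\<^sup>+x\<in>\<Omega> \<inter> ball x0 \<rho>0. ennreal (\<bar>u x\<bar> powr ?m') \<partial>leb)
      \<le> (\<integral>\<^sup>+x. ennreal (?A powr ?m') * (1 + ?U x) \<partial>leb)"
    by (intro nn_integral_mono) auto
  also have "\<dots> = ennreal (?A powr ?m') * (emeasure leb \<Omega> + (\<integral>\<^sup>+x. ?U x \<partial>leb))"
    by (simp add: nn_integral_cmult nn_integral_add)
  also have "\<dots> \<le> ennreal (?A powr ?m') * (ennreal (measure leb \<Omega>) + ennreal K)"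
    using UK by (intro mult_left_mono add_mono) (auto simp: leb.emeasure_eq_measure)
  also have "\<dots> = ennreal (?A powr ?m' * (measure leb \<Omega> + K))"
    using K by (simp add: ennreal_mult)
  finally show ?thesis .
qed

text \<open>The ball is chosen before \<open>K\<close>; only the bound may depend on \<open>K\<close>.\<close>

definition locally_bounded_power :: "'a \<Rightarrow> real \<Rightarrow> bool" where
  "locally_bounded_power x0 m \<longleftrightarrow> (\<exists>b>0. \<forall>K. \<exists>C. \<forall>u\<in>modular_ball K.
     (\<integral>\<^sup>+x\<in>\<Omega> \<inter> ball x0 b. ennreal (\<bar>u x\<bar> powr m) \<partial>leb) \<le> ennreal C)"

text \<open>The maximum is there because \<open>ennreal C\<close> is 0 for negative \<open>C\<close>.\<close>

lemma nn_integral_le_of_le_one_plus: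
  assumes f: "f \<in> borel_measurable leb" and C: "(\<integral>\<^sup>+x. f x \<partial>leb) \<le> ennreal C"
    and g: "\<And>x. x \<in> \<Omega> \<Longrightarrow> g x \<le> 1 + f x"
  shows "(\<integral>\<^sup>+x. g x \<partial>leb) \<le> ennreal (measure leb \<Omega> + max 0 C)"
proof -
  have "(\<integral>\<^sup>+x. g x \<partial>leb) \<le> (\<integral>\<^sup>+x. 1 + f x \<partial>leb)"
    using g by (intro nn_integral_mono) auto
  also have "\<dots> = emeasure leb \<Omega> + (\<integral>\<^sup>+x. f x \<partial>leb)"
    using f by (simp add: nn_integral_add)
  also have "\<dots> \<le> ennreal (measure leb \<Omega>) + ennreal (max 0 C)"
    using C by (intro add_mono) (auto simp: leb.emeasure_eq_measure max_def ennreal_neg split: if_splits)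
  finally show ?thesis by (simp flip: ennreal_plus)
qed

lemma locally_bounded_power_le:
  assumes "locally_bounded_power x0 m'" and "0 \<le> m" "m \<le> m'"
  shows "locally_bounded_power x0 m"
proof -
  obtain b where b: "0 < b" and *: "\<And>K. \<exists>C. \<forall>u\<in>modular_ball K.
     (\<integral>\<^sup>+x\<in>\<Omega> \<inter> ball x0 b. ennreal (\<bar>u x\<bar> powr m') \<partial>leb) \<le> ennreal C"
    using assms(1) unfolding locally_bounded_power_def by blast
  have "\<exists>C. \<forall>u\<in>modular_ball K.
     (\<integral>\<^sup>+x\<in>\<Omega> \<inter> ball x0 b. ennreal (\<bar>u x\<bar> powr m) \<partial>leb) \<le> ennreal C" for K
  proof -
    obtain C where C: "\<And>u. u \<in> modular_ball K \<Longrightarrow>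
      (\<integral>\<^sup>+x\<in>\<Omega> \<inter> ball x0 b. ennreal (\<bar>u x\<bar> powr m') \<partial>leb) \<le> ennreal C"
      using * by blast
    have "(\<integral>\<^sup>+x\<in>\<Omega> \<inter> ball x0 b. ennreal (\<bar>u x\<bar> powr m) \<partial>leb) \<le> ennreal (measure leb \<Omega> + max 0 C)"
      if u: "u \<in> modular_ball K" for u
    proof (rule nn_integral_le_of_le_one_plus[OF _ C[OF u]])
      have [measurable]: "u \<in> borel_measurable leb" using u by (simp add: modular_ball_def)
      have [measurable]: "\<Omega> \<inter> ball x0 b \<in> sets leb"
        using open_domain by (intro open_in_sets_leb) auto
      show "(\<lambda>x. ennreal (\<bar>u x\<bar> powr m') * indicator (\<Omega> \<inter> ball x0 b) x) \<in> borel_measurable leb"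
        by measurable
      have "ennreal (\<bar>u x\<bar> powr m) \<le> 1 + ennreal (\<bar>u x\<bar> powr m')" for x
        using ennreal_leI[OF powr_le_one_plus[of "\<bar>u x\<bar>" m m']] assms by simp
      then show "ennreal (\<bar>u x\<bar> powr m) * indicator (\<Omega> \<inter> ball x0 b) x
          \<le> 1 + ennreal (\<bar>u x\<bar> powr m') * indicator (\<Omega> \<inter> ball x0 b) x" for x
        by (simp add: indicator_def)
    qed
    then show ?thesis by blast
  qed
  then show ?thesis unfolding locally_bounded_power_def using b by blast
qed

lemma locally_bounded_power_one: "locally_bounded_power x0 1"
proof -
  have "(\<integral>\<^sup>+x\<in>\<Omega> \<inter> ball x0 1. ennreal (\<bar>u x\<bar> powr 1) \<partial>leb) \<le> ennreal (measure leb \<Omega> + max 0 K)"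
    if u: "u \<in> modular_ball K" for u K
  proof (rule nn_integral_le_of_le_one_plus)
    have [measurable]: "u \<in> borel_measurable leb" using u by (simp add: modular_ball_def)
    have [measurable]: "q \<in> borel_measurable leb"
      by (rule continuous_imp_measurable[OF q_continuous])
    show "(\<lambda>x. ennreal (\<bar>u x\<bar> powr q x)) \<in> borel_measurable leb" by measurable
    show "(\<integral>\<^sup>+x. ennreal (\<bar>u x\<bar> powr q x) \<partial>leb) \<le> ennreal K"
      using u by (simp add: modular_ball_def)
    show "ennreal (\<bar>u x\<bar> powr 1) * indicator (\<Omega> \<inter> ball x0 1) x \<le> 1 + ennreal (\<bar>u x\<bar> powr q x)"
      if "x \<in> \<Omega>" for x
    proof -
      have "\<bar>u x\<bar> powr 1 \<le> 1 + \<bar>u x\<bar> powr q x"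
        using q_bounds[OF in_closure[OF that]] sigma_gt_1 by (intro powr_le_one_plus) auto
      then show ?thesis using ennreal_leI by (fastforce simp: indicator_def)
    qed
  qed
  then show ?thesis unfolding locally_bounded_power_def using zero_less_one by blast
qed

text \<open>The new ball is contained in the old one, in the region of measure density, and in a neighbourhood of \<open>x0\<close> where
  \<open>p \<ge> p0\<close> by continuity.\<close>

lemma locally_bounded_power_step:
  assumes lip: "lipschitz_domain \<Omega>" and x0: "x0 \<in> closure \<Omega>"
    and p0: "0 < p0" "p0 < p (x0, x0)" and m: "0 < m" and lb: "locally_bounded_power x0 m"
  shows "locally_bounded_power x0 (p0 * (1 + s * m / real DIM('a)))"
proof -
  obtain b1 where b1: "0 < b1" and *: "\<And>K. \<exists>C. \<forall>u\<in>modular_ball K.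
     (\<integral>\<^sup>+x\<in>\<Omega> \<inter> ball x0 b1. ennreal (\<bar>u x\<bar> powr m) \<partial>leb) \<le> ennreal C"
    using lb unfolding locally_bounded_power_def by blast
  obtain c \<rho>1 where c: "0 < c" "0 < \<rho>1"
    "\<And>x \<rho>. x \<in> \<Omega> \<inter> ball x0 \<rho>1 \<Longrightarrow> 0 < \<rho> \<Longrightarrow> \<rho> \<le> \<rho>1 \<Longrightarrow>
       c * \<rho> ^ DIM('a) \<le> measure lebesgue (\<Omega> \<inter> ball x \<rho>)"
    by (rule lipschitz_domain_measure_density[OF lip x0]) blast
  obtain d where d: "0 < d" "\<And>z. z \<in> closure \<Omega> \<times> closure \<Omega> \<Longrightarrow> dist z (x0, x0) < d \<Longrightarrow>
      dist (p z) (p (x0, x0)) < p (x0, x0) - p0"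
    using p_continuous x0 p0 unfolding continuous_on_iff
    by (metis SigmaI diff_gt_0_iff_gt)
  define b where "b = min b1 (min (2 * \<rho>1) (d / 2))"
  have b: "0 < b" "b \<le> b1" "b / 2 \<le> \<rho>1" "b \<le> d / 2" using b1 c d by (auto simp: b_def)
  have pb: "p0 \<le> p (x, y)" if "x \<in> \<Omega> \<inter> ball x0 b" "y \<in> \<Omega> \<inter> ball x0 b" for x y
  proof -
    have "dist (x, y) (x0, x0) \<le> dist x x0 + dist y x0"
      unfolding dist_Pair_Pair by (rule sqrt_sum_squares_le_sum) auto
    also have "\<dots> < d" using that b by (auto simp: dist_commute)
    finally have "dist (p (x, y)) (p (x0, x0)) < p (x0, x0) - p0"
      using d(2)[of "(x, y)"] that in_closure by auto
    then show ?thesis by (auto simp: dist_real_def)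
  qed
  have "\<exists>C. \<forall>u\<in>modular_ball K. (\<integral>\<^sup>+x\<in>\<Omega> \<inter> ball x0 (b / 2).
      ennreal (\<bar>u x\<bar> powr (p0 * (1 + s * m / real DIM('a)))) \<partial>leb) \<le> ennreal C" for K
  proof -
    obtain M where M: "\<And>u. u \<in> modular_ball (max 0 K) \<Longrightarrow>
      (\<integral>\<^sup>+x\<in>\<Omega> \<inter> ball x0 b1. ennreal (\<bar>u x\<bar> powr m) \<partial>leb) \<le> ennreal M"
      using * by blast
    have M': "(\<integral>\<^sup>+x\<in>\<Omega> \<inter> ball x0 b. ennreal (\<bar>u x\<bar> powr m) \<partial>leb) \<le> ennreal (max 1 M)"
      if "u \<in> modular_ball (max 0 K)" for u
    proof -
      have "(\<integral>\<^sup>+x\<in>\<Omega> \<inter> ball x0 b. ennreal (\<bar>u x\<bar> powr m) \<partial>leb)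
          \<le> (\<integral>\<^sup>+x\<in>\<Omega> \<inter> ball x0 b1. ennreal (\<bar>u x\<bar> powr m) \<partial>leb)"
        using b by (intro nn_integral_mono) (auto simp: indicator_def)
      also have "\<dots> \<le> ennreal M" by (rule M[OF that])
      also have "\<dots> \<le> ennreal (max 1 M)" by (rule ennreal_leI) simp
      finally show ?thesis .
    qed
    have cc: "min c 4 * \<rho> ^ DIM('a) \<le> measure lebesgue (\<Omega> \<inter> ball x \<rho>)"
      if "x \<in> \<Omega> \<inter> ball x0 (b / 2)" "0 < \<rho>" "\<rho> \<le> b / 2" for x \<rho>
    proof -
      have "min c 4 * \<rho> ^ DIM('a) \<le> c * \<rho> ^ DIM('a)" using that by (intro mult_right_mono) auto
      also have "\<dots> \<le> measure lebesgue (\<Omega> \<inter> ball x \<rho>)" using that b c(3)[of x \<rho>] by auto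
      finally show ?thesis .
    qed
    have sub: "modular_ball K \<subseteq> modular_ball (max 0 K)" by (rule modular_ball_mono) simp
    show ?thesis
      by (rule exI, rule ballI, rule integral_gain[OF subsetD[OF sub] _ _ _ _ _ cc p0(1) pb m _ M'[OF subsetD[OF sub]]])
        (use b c in auto)
  qed
  then show ?thesis unfolding locally_bounded_power_def using b by (intro exI[of _ "b / 2"]) auto
qed

text \<open>With \<open>\<theta> = s * p0 / DIM('a) < 1\<close>, one step maps \<open>m\<close> to \<open>p0 + \<theta> * m\<close>, an affine contraction with the critical
  exponent as its fixed point. Started at 1, it reaches every smaller exponent in
  finitely many steps, so the balls shrink only finitely often.\<close>

lemma locally_bounded_power_subcritical:
  assumes lip: "lipschitz_domain \<Omega>" and x0: "x0 \<in> closure \<Omega>"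
    and p0: "0 < p0" "p0 < p (x0, x0)" "s * p0 < real DIM('a)"
    and m: "1 < m" "m < real DIM('a) * p0 / (real DIM('a) - s * p0)"
  shows "locally_bounded_power x0 m"
proof -
  define \<theta> where "\<theta> = s * p0 / real DIM('a)"
  define ms where "ms = real DIM('a) * p0 / (real DIM('a) - s * p0)"
  have \<theta>: "0 < \<theta>" "\<theta> < 1" using s_pos p0 by (auto simp: \<theta>_def)
  have fixpoint: "p0 + \<theta> * ms = ms"
    using p0 by (simp add: \<theta>_def ms_def field_simps)
  have ms: "1 < ms" "m < ms" using m by (auto simp: ms_def)
  \<comment> \<open>The iterates of the contraction from the starting point 1, in closed form.\<close>
  define mk where "mk = (\<lambda>k::nat. ms - \<theta> ^ k * (ms - 1))"
  have mk1: "1 \<le> mk k" for k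
  proof -
    have "\<theta> ^ k * (ms - 1) \<le> 1 * (ms - 1)"
      using \<theta> ms by (intro mult_right_mono power_le_one) auto
    then show ?thesis by (simp add: mk_def)
  qed
  have bdd: "locally_bounded_power x0 (mk k)" for k
  proof (induction k)
    case 0
    then show ?case using locally_bounded_power_one by (simp add: mk_def)
  next
    case (Suc k)
    have "mk (Suc k) = p0 + \<theta> * mk k"
      using fixpoint by (simp add: mk_def algebra_simps)
    also have "\<dots> = p0 * (1 + s * mk k / real DIM('a))"
      by (simp add: \<theta>_def algebra_simps)
    finally show ?case
      using locally_bounded_power_step[OF lip x0 p0(1,2) _ Suc] mk1[of k] by simp
  qed
  have "\<exists>k. m \<le> mk k"
  proof -
    obtain k where "\<theta> ^ k < (ms - m) / (ms - 1)"
      using real_arch_pow_inv[of "(ms - m) / (ms - 1)" \<theta>] ms \<theta> by auto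
    then show ?thesis using ms by (intro exI[of _ k]) (simp add: mk_def field_simps)
  qed
  then obtain k where k: "m \<le> mk k" by blast
  show ?thesis by (rule locally_bounded_power_le[OF _ _ k]) (use m bdd in auto)
qed

text \<open>Since \<open>r x0\<close> is strictly below the critical exponent of \<open>p (x0, x0)\<close>, it is also below that of some \<open>p0\<close>
  slightly smaller than \<open>p (x0, x0)\<close>. Continuity of \<open>r\<close> then keeps \<open>r + \<delta>\<close> below a fixed subcritical exponent
  near \<open>x0\<close>. Uniformity in \<open>\<delta>' \<le> \<delta>\<close> allows a common \<open>\<delta>\<close> to be chosen for a finite cover.\<close>

lemma local_higher_integrability:
  assumes lip: "lipschitz_domain \<Omega>" and sP: "s * P < real DIM('a)"
    and r_cont: "continuous_on (closure \<Omega>) r" and x0: "x0 \<in> closure \<Omega>"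
    and r_gt: "1 < r x0"
    and r_less: "r x0 < real DIM('a) * p (x0, x0) / (real DIM('a) - s * p (x0, x0))"
  shows "\<exists>b>0. \<exists>\<delta>>0. \<forall>K. \<exists>C. \<forall>u\<in>modular_ball K. \<forall>\<delta>'. 0 \<le> \<delta>' \<longrightarrow> \<delta>' \<le> \<delta> \<longrightarrow>
     (\<integral>\<^sup>+x\<in>\<Omega> \<inter> ball x0 b. ennreal (\<bar>u x\<bar> powr (r x + \<delta>')) \<partial>leb) \<le> ennreal C"
proof -
  define N where "N = real DIM('a)"
  \<comment> \<open>The exponent whose critical exponent is exactly \<open>r x0\<close>.\<close>
  define p1 where "p1 = N * r x0 / (N + s * r x0)"
  define p0 where "p0 = (p1 + p (x0, x0)) / 2"
  have N: "0 < N" by (simp add: N_def)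
  have pp: "1 \<le> p (x0, x0)" "s * p (x0, x0) < N"
    using p_bounds[OF x0 x0] sP mult_left_mono[of "p (x0, x0)" P s] s_pos unfolding N_def by linarith+
  have sr: "0 < N + s * r x0" using N s_pos r_gt by (simp add: add_pos_pos)
  have "0 < p1" using sr N r_gt by (simp add: p1_def)
  have "p1 < p (x0, x0)"
    using r_less pp sr by (simp add: p1_def N_def[symmetric] field_simps)
  then have p0: "0 < p0" "p1 < p0" "p0 < p (x0, x0)" using \<open>0 < p1\<close> by (auto simp: p0_def)
  have sp0: "s * p0 < N" using p0 pp s_pos mult_strict_left_mono[of p0 "p (x0, x0)" s] by linarith
  have gr: "r x0 < N * p0 / (N - s * p0)"
    using p0(2) sr sp0 by (simp add: p1_def field_simps)
  obtain m where m: "r x0 < m" "m < N * p0 / (N - s * p0)" using dense[OF gr] by blast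
  have "locally_bounded_power x0 m"
    using locally_bounded_power_subcritical[OF lip x0 p0(1,3)] sp0 m r_gt by (simp add: N_def)
  then obtain b1 where b1: "0 < b1" and *: "\<And>K. \<exists>C. \<forall>u\<in>modular_ball K.
     (\<integral>\<^sup>+x\<in>\<Omega> \<inter> ball x0 b1. ennreal (\<bar>u x\<bar> powr m) \<partial>leb) \<le> ennreal C"
    unfolding locally_bounded_power_def by blast
  define \<delta> where "\<delta> = (m - r x0) / 2"
  have \<delta>: "0 < \<delta>" using m by (simp add: \<delta>_def)
  define \<epsilon> where "\<epsilon> = min \<delta> (r x0 - 1)"
  have \<epsilon>: "0 < \<epsilon>" "\<epsilon> \<le> \<delta>" "\<epsilon> \<le> r x0 - 1" using \<delta> r_gt by (auto simp: \<epsilon>_def)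
  then obtain d where d: "0 < d" "\<And>x. x \<in> closure \<Omega> \<Longrightarrow> dist x x0 < d \<Longrightarrow> dist (r x) (r x0) < \<epsilon>"
    using r_cont x0 unfolding continuous_on_iff by metis
  define b where "b = min b1 d"
  have b: "0 < b" using b1 d by (simp add: b_def)
  have bnd: "\<exists>C. \<forall>u\<in>modular_ball K. \<forall>\<delta>'. 0 \<le> \<delta>' \<longrightarrow> \<delta>' \<le> \<delta> \<longrightarrow>
     (\<integral>\<^sup>+x\<in>\<Omega> \<inter> ball x0 b. ennreal (\<bar>u x\<bar> powr (r x + \<delta>')) \<partial>leb) \<le> ennreal C" for K
  proof -
    obtain C where C: "\<And>u. u \<in> modular_ball K \<Longrightarrow>
      (\<integral>\<^sup>+x\<in>\<Omega> \<inter> ball x0 b1. ennreal (\<bar>u x\<bar> powr m) \<partial>leb) \<le> ennreal C"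
      using * by blast
    have "(\<integral>\<^sup>+x\<in>\<Omega> \<inter> ball x0 b. ennreal (\<bar>u x\<bar> powr (r x + \<delta>')) \<partial>leb)
        \<le> ennreal (measure leb \<Omega> + max 0 C)"
      if u: "u \<in> modular_ball K" and \<delta>': "0 \<le> \<delta>'" "\<delta>' \<le> \<delta>" for u \<delta>'
    proof (rule nn_integral_le_of_le_one_plus[OF _ C[OF u]])
      have [measurable]: "u \<in> borel_measurable leb" using u by (simp add: modular_ball_def)
      have [measurable]: "\<Omega> \<inter> ball x0 b1 \<in> sets leb"
        using open_domain by (intro open_in_sets_leb) auto
      show "(\<lambda>x. ennreal (\<bar>u x\<bar> powr m) * indicator (\<Omega> \<inter> ball x0 b1) x) \<in> borel_measurable leb"
        by measurable
      show "ennreal (\<bar>u x\<bar> powr (r x + \<delta>')) * indicator (\<Omega> \<inter> ball x0 b) x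
          \<le> 1 + ennreal (\<bar>u x\<bar> powr m) * indicator (\<Omega> \<inter> ball x0 b1) x" if "x \<in> \<Omega>" for x
      proof (cases "x \<in> ball x0 b")
        case True
        then have "dist (r x) (r x0) < \<epsilon>"
          using that by (intro d) (auto simp: b_def in_closure dist_commute)
        then have "r x < r x0 + \<epsilon>" "r x0 - \<epsilon> < r x"
          unfolding dist_real_def by linarith+
        moreover have "2 * \<delta> = m - r x0" by (simp add: \<delta>_def)
        ultimately have "0 \<le> r x + \<delta>'" "r x + \<delta>' \<le> m"
          using \<delta>' r_gt \<epsilon> by linarith+
        then have "\<bar>u x\<bar> powr (r x + \<delta>') \<le> 1 + \<bar>u x\<bar> powr m"
          by (intro powr_le_one_plus) auto
        from ennreal_leI[OF this] show ?thesis
          using True that by (simp add: indicator_def b_def)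
      qed auto
    qed
    then show ?thesis by blast
  qed
  show ?thesis
    by (rule exI[of _ b], intro conjI b, rule exI[of _ \<delta>], intro conjI \<delta> allI, rule bnd)
qed

lemma higher_integrability:
  assumes lip: "lipschitz_domain \<Omega>" and sP: "s * P < real DIM('a)"
    and r_cont: "continuous_on (closure \<Omega>) r" and r_gt: "\<And>x. x \<in> closure \<Omega> \<Longrightarrow> 1 < r x"
    and r_less: "\<And>x. x \<in> closure \<Omega> \<Longrightarrow>
      r x < real DIM('a) * p (x, x) / (real DIM('a) - s * p (x, x))"
  obtains \<delta> where "0 < \<delta>" "\<And>K. \<exists>C\<ge>0. \<forall>u\<in>modular_ball K.
     (\<integral>\<^sup>+x. ennreal (\<bar>u x\<bar> powr (r x + \<delta>)) \<partial>leb) \<le> ennreal C"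
proof -
  define good where "good = (\<lambda>x0 b \<delta>. \<forall>K. \<exists>C. \<forall>u\<in>modular_ball K.
     \<forall>\<delta>'. 0 \<le> \<delta>' \<longrightarrow> \<delta>' \<le> \<delta> \<longrightarrow>
     (\<integral>\<^sup>+x\<in>\<Omega> \<inter> ball x0 b. ennreal (\<bar>u x\<bar> powr (r x + \<delta>')) \<partial>leb) \<le> ennreal C)"
  have "\<forall>x0\<in>closure \<Omega>. \<exists>b>0. \<exists>\<delta>>0. good x0 b \<delta>"
    unfolding good_def
    by (intro ballI local_higher_integrability[OF lip sP r_cont _ r_gt r_less])
  then obtain b d where b: "\<And>x. x \<in> closure \<Omega> \<Longrightarrow> 0 < b x" and d: "\<And>x. x \<in> closure \<Omega> \<Longrightarrow> 0 < (d x :: real)"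
    and good: "\<And>x. x \<in> closure \<Omega> \<Longrightarrow> good x (b x) (d x)"
    by metis
  have cpt: "compact (closure \<Omega>)" using bounded_domain by (simp add: compact_closure)
  have cov: "closure \<Omega> \<subseteq> (\<Union>x\<in>closure \<Omega>. ball x (b x))" using b by force
  obtain F where F: "F \<subseteq> closure \<Omega>" "finite F" "closure \<Omega> \<subseteq> (\<Union>x\<in>F. ball x (b x))"
    by (rule compactE_image[OF cpt _ cov]) auto
  \<comment> \<open>The 1 only serves to make the set nonempty.\<close>
  define \<delta> where "\<delta> = Min (insert 1 (d ` F))"
  have \<delta>: "0 < \<delta>" "\<And>x. x \<in> F \<Longrightarrow> \<delta> \<le> d x"
    using F d by (auto simp: \<delta>_def)
  have [measurable]: "r \<in> borel_measurable leb" by (rule continuous_imp_measurable[OF r_cont])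
  have "\<exists>C\<ge>0. \<forall>u\<in>modular_ball K. (\<integral>\<^sup>+x. ennreal (\<bar>u x\<bar> powr (r x + \<delta>)) \<partial>leb) \<le> ennreal C" for K
  proof -
    have "\<forall>x0\<in>F. \<exists>C. \<forall>u\<in>modular_ball K.
      (\<integral>\<^sup>+x\<in>\<Omega> \<inter> ball x0 (b x0). ennreal (\<bar>u x\<bar> powr (r x + \<delta>)) \<partial>leb) \<le> ennreal C"
    proof
      fix x0 assume "x0 \<in> F"
      then have "x0 \<in> closure \<Omega>" using F by auto
      obtain C where C: "\<forall>u\<in>modular_ball K. \<forall>\<delta>'. 0 \<le> \<delta>' \<longrightarrow> \<delta>' \<le> d x0 \<longrightarrow>
         (\<integral>\<^sup>+x\<in>\<Omega> \<inter> ball x0 (b x0). ennreal (\<bar>u x\<bar> powr (r x + \<delta>')) \<partial>leb) \<le> ennreal C"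
        using good[OF \<open>x0 \<in> closure \<Omega>\<close>, unfolded good_def, rule_format, of K] by (elim exE)
      have "0 \<le> \<delta>" "\<delta> \<le> d x0" using \<delta>(1) \<delta>(2)[OF \<open>x0 \<in> F\<close>] by auto
      with C show "\<exists>C. \<forall>u\<in>modular_ball K.
        (\<integral>\<^sup>+x\<in>\<Omega> \<inter> ball x0 (b x0). ennreal (\<bar>u x\<bar> powr (r x + \<delta>)) \<partial>leb) \<le> ennreal C"
        by (intro exI[of _ C] ballI) simp
    qed
    from bchoice[OF this] obtain C where C: "\<And>x0 u. x0 \<in> F \<Longrightarrow> u \<in> modular_ball K \<Longrightarrow>
      (\<integral>\<^sup>+x\<in>\<Omega> \<inter> ball x0 (b x0). ennreal (\<bar>u x\<bar> powr (r x + \<delta>)) \<partial>leb) \<le> ennreal (C x0)"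
      by (elim exE) blast
    show ?thesis
    proof (intro exI conjI ballI)
    fix u assume u: "u \<in> modular_ball K"
    have [measurable]: "u \<in> borel_measurable leb" using u by (simp add: modular_ball_def)
    have [measurable]: "\<Omega> \<inter> ball x (b x) \<in> sets leb" for x
        using open_domain by (intro open_in_sets_leb) auto
    have "(\<integral>\<^sup>+x. ennreal (\<bar>u x\<bar> powr (r x + \<delta>)) \<partial>leb)
      \<le> (\<integral>\<^sup>+x. (\<Sum>y\<in>F. ennreal (\<bar>u x\<bar> powr (r x + \<delta>)) * indicator (\<Omega> \<inter> ball y (b y)) x) \<partial>leb)"
    proof (intro nn_integral_mono)
      fix x assume "x \<in> space leb"
      then have x: "x \<in> \<Omega>" by simp
      then obtain y where y: "y \<in> F" "x \<in> ball y (b y)" using F in_closure by blast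
      have "ennreal (\<bar>u x\<bar> powr (r x + \<delta>)) = ennreal (\<bar>u x\<bar> powr (r x + \<delta>)) * indicator (\<Omega> \<inter> ball y (b y)) x"
        using x y by simp
      also have "\<dots> \<le> (\<Sum>y\<in>F. ennreal (\<bar>u x\<bar> powr (r x + \<delta>)) * indicator (\<Omega> \<inter> ball y (b y)) x)"
        using y F by (intro member_le_sum) auto
      finally show "ennreal (\<bar>u x\<bar> powr (r x + \<delta>))
        \<le> (\<Sum>y\<in>F. ennreal (\<bar>u x\<bar> powr (r x + \<delta>)) * indicator (\<Omega> \<inter> ball y (b y)) x)" .
    qed
    also have "\<dots> = (\<Sum>y\<in>F. \<integral>\<^sup>+x\<in>\<Omega> \<inter> ball y (b y). ennreal (\<bar>u x\<bar> powr (r x + \<delta>)) \<partial>leb)"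
      by (intro nn_integral_sum) measurable
    also have "\<dots> \<le> (\<Sum>y\<in>F. ennreal (max 0 (C y)))"
    proof (intro sum_mono)
      fix y assume y: "y \<in> F"
      have "(\<integral>\<^sup>+x\<in>\<Omega> \<inter> ball y (b y). ennreal (\<bar>u x\<bar> powr (r x + \<delta>)) \<partial>leb) \<le> ennreal (C y)"
        by (rule C[OF y u])
      also have "\<dots> \<le> ennreal (max 0 (C y))" by (rule ennreal_leI) simp
      finally show "(\<integral>\<^sup>+x\<in>\<Omega> \<inter> ball y (b y). ennreal (\<bar>u x\<bar> powr (r x + \<delta>)) \<partial>leb)
        \<le> ennreal (max 0 (C y))" .
    qed
    also have "\<dots> = ennreal (\<Sum>y\<in>F. max 0 (C y))" by (intro sum_ennreal) auto
    finally show "(\<integral>\<^sup>+x. ennreal (\<bar>u x\<bar> powr (r x + \<delta>)) \<partial>leb) \<le> ennreal (\<Sum>y\<in>F. max 0 (C y))" .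
    qed (auto intro: sum_nonneg)
  qed
  then show ?thesis using that[OF \<delta>(1)] by blast
qed

section \<open>Almost everywhere convergent subsequences\<close>

text \<open>The ratio of \<open>(2 * h) ^ DIM('a)\<close> to the measure of a ball of radius \<open>h\<close>, for any \<open>h\<close>.\<close>

definition ball_constant :: real where
  "ball_constant = 2 ^ DIM('a) / measure lborel (ball (0::'a) 1)"

lemma ball_constant_pos: "0 < ball_constant"
  by (simp add: ball_constant_def content_ball_pos)

text \<open>Let \<open>D\<close> be the difference quotient of order \<open>s\<close> between \<open>y\<close> and \<open>x\<close>. Since the exponent is at least 1,
  \<open>D\<close> is at most \<open>1 + D powr p (y, x)\<close>, and the power is the Gagliardo quotient times the distance to the power
  \<open>DIM('a)\<close>. Averaging over \<open>y\<close> in the ball compares that power of the distance with the measure of the ball.\<close>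

lemma ball_mean_oscillation:
  assumes u: "integrable leb u" and x: "x \<in> ball z h" and h: "0 < h" and sub: "ball z h \<subseteq> \<Omega>"
    and U: "gagliardo_potential \<Omega> s p u x = ennreal U" "0 \<le> U"
  shows "\<bar>u x - (LINT y|leb. indicator (ball z h) y * u y) / measure lborel (ball z h)\<bar>
    \<le> (2 * h) powr s * (1 + ball_constant * U)"
proof -
  define B where "B = ball z h"
  define \<omega> where "\<omega> = measure lborel (ball (0::'a) 1)"
  define g where "g = (\<lambda>y. gagliardo_quotient s p u y x)"
  have g0: "0 \<le> g y" for y by (simp add: g_def gagliardo_quotient_nonneg)
  have \<omega>: "0 < \<omega>" by (simp add: \<omega>_def content_ball_pos)
  have mB: "measure lborel B = h ^ DIM('a) * \<omega>"
    using content_ball_conv_unit_ball[of h z] h by (simp add: B_def \<omega>_def)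
  have x\<Omega>: "x \<in> \<Omega>" using x sub by auto
  have B[measurable]: "B \<in> sets leb" using sub by (auto simp: B_def intro: open_in_sets_leb)
  have mB': "measure leb B = measure lborel B"
    using emeasure_leb[OF B] by (simp add: measure_def B_def)
  have [measurable]: "u \<in> borel_measurable leb" using u by auto
  have [measurable]: "g \<in> borel_measurable leb"
    using quotient_measurable[OF _ x\<Omega>, of u] by (simp add: g_def)
  have gU: "(\<integral>\<^sup>+y. ennreal (g y) \<partial>leb) = ennreal U"
    using U by (simp add: g_def gagliardo_potential_def)
  have pt: "\<bar>u y - u x\<bar> \<le> (2 * h) powr s * (1 + (2 * h) ^ DIM('a) * g y)" if "y \<in> B" for y
  proof (cases "y = x")
    case False
    define e where "e = p (y, x)"
    define t where "t = norm (y - x)"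
    define D where "D = \<bar>u y - u x\<bar> / t powr s"
    have e: "1 \<le> e" unfolding e_def using p_bounds that sub in_closure x\<Omega> by (auto simp: B_def)
    have "t < 2 * h"
      using that x norm_triangle_ineq4[of "y - z" "x - z"]
      by (simp add: t_def B_def dist_norm norm_minus_commute)
    moreover have "0 < t" using False by (simp add: t_def)
    ultimately have t: "0 < t" "t \<le> 2 * h" by auto
    have "D powr e = \<bar>u y - u x\<bar> powr e / t powr (s * e)"
      using t by (simp add: D_def powr_divide powr_powr)
    also have "\<dots> = t powr real DIM('a) * g y"
      using t by (simp add: g_def gagliardo_quotient_def e_def[symmetric] t_def[symmetric] powr_add)
    also have "\<dots> \<le> (2 * h) powr real DIM('a) * g y"
      using t g0 by (intro mult_right_mono powr_mono2) auto
    also have "\<dots> = (2 * h) ^ DIM('a) * g y" using h by (simp add: powr_realpow)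
    finally have De: "D powr e \<le> (2 * h) ^ DIM('a) * g y" .
    have "0 \<le> D" by (simp add: D_def)
    then have "D powr 1 \<le> 1 + D powr e" using e by (intro powr_le_one_plus) auto
    then have "D \<le> 1 + (2 * h) ^ DIM('a) * g y" using De \<open>0 \<le> D\<close> by simp
    moreover have "t powr s \<le> (2 * h) powr s" using t s_pos by (intro powr_mono2) auto
    ultimately have "t powr s * D \<le> (2 * h) powr s * (1 + (2 * h) ^ DIM('a) * g y)"
      using \<open>0 \<le> D\<close> by (intro mult_mono) auto
    then show ?thesis using t by (simp add: D_def)
  qed (use g0 h in auto)
  have int: "integrable leb (\<lambda>y. indicator B y * u y)"
    using integrable_mult_indicator[OF B u] by simp
  have int1: "integrable leb (\<lambda>y. indicator B y * u x)" by (simp add: leb.emeasure_eq_measure)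
  have "measure lborel B * u x - (LINT y|leb. indicator B y * u y)
      = (LINT y|leb. indicator B y * u x - indicator B y * u y)"
    using int int1 sub mB' by (simp add: B_def Int_absorb2)
  then have "ennreal \<bar>measure lborel B * u x - (LINT y|leb. indicator B y * u y)\<bar>
      \<le> (\<integral>\<^sup>+y. ennreal (norm (indicator B y * u x - indicator B y * u y)) \<partial>leb)"
    using integral_norm_bound_ennreal[OF Bochner_Integration.integrable_diff[OF int1 int]] by simp
  also have "\<dots> \<le> (\<integral>\<^sup>+y. ennreal ((2 * h) powr s) * indicator B y
      + ennreal ((2 * h) powr s * (2 * h) ^ DIM('a)) * ennreal (g y) \<partial>leb)"
  proof (intro nn_integral_mono)
    fix y
    show "ennreal (norm (indicator B y * u x - indicator B y * u y)) \<le> ennreal ((2 * h) powr s) * indicator B y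
      + ennreal ((2 * h) powr s * (2 * h) ^ DIM('a)) * ennreal (g y)"
    proof (cases "y \<in> B")
      case True
      have "ennreal \<bar>u y - u x\<bar> \<le> ennreal ((2 * h) powr s * (1 + (2 * h) ^ DIM('a) * g y))"
        by (rule ennreal_leI[OF pt[OF True]])
      also have "\<dots> = ennreal ((2 * h) powr s) + ennreal ((2 * h) powr s * (2 * h) ^ DIM('a)) * ennreal (g y)"
        using g0 h by (simp add: ennreal_mult[symmetric] ennreal_plus[symmetric] algebra_simps del: ennreal_plus)
      finally show ?thesis using True by (simp add: abs_minus_commute)
    qed auto
  qed
  also have "\<dots> = ennreal ((2 * h) powr s) * emeasure leb B
      + ennreal ((2 * h) powr s * (2 * h) ^ DIM('a)) * ennreal U"
    by (simp add: nn_integral_add nn_integral_cmult gU)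
  also have "\<dots> = ennreal ((2 * h) powr s * (measure lborel B + (2 * h) ^ DIM('a) * U))"
    using h U by (simp add: leb.emeasure_eq_measure mB' ennreal_mult[symmetric] ennreal_plus[symmetric]
        algebra_simps del: ennreal_plus)
  finally have "\<bar>measure lborel B * u x - (LINT y|leb. indicator B y * u y)\<bar>
      \<le> (2 * h) powr s * (measure lborel B + (2 * h) ^ DIM('a) * U)"
    using U h by (simp add: ennreal_le_iff)
  moreover have "0 < measure lborel B" using \<omega> h by (simp add: mB)
  ultimately have "\<bar>measure lborel B * u x - (LINT y|leb. indicator B y * u y)\<bar> / measure lborel B
      \<le> (2 * h) powr s * (measure lborel B + (2 * h) ^ DIM('a) * U) / measure lborel B"
    by (intro divide_right_mono) auto
  also have "\<dots> = (2 * h) powr s * (1 + ball_constant * U)"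
    using h \<omega> by (simp add: mB ball_constant_def \<omega>_def[symmetric] field_simps)
  also have "\<bar>measure lborel B * u x - (LINT y|leb. indicator B y * u y)\<bar> / measure lborel B
      = \<bar>u x - (LINT y|leb. indicator B y * u y) / measure lborel B\<bar>"
  proof -
    have "(measure lborel B * u x - (LINT y|leb. indicator B y * u y)) / measure lborel B
        = u x - (LINT y|leb. indicator B y * u y) / measure lborel B"
      using \<open>0 < measure lborel B\<close> by (simp add: diff_divide_distrib)
    then show ?thesis using \<open>0 < measure lborel B\<close> by (metis abs_div_pos)
  qed
  finally show ?thesis by (simp add: B_def)
qed

lemma modular_ball_L1:
  assumes u: "u \<in> modular_ball K" and K: "0 \<le> K"
  shows "(\<integral>\<^sup>+x. ennreal \<bar>u x\<bar> \<partial>leb) \<le> ennreal (measure leb \<Omega> + K)"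
    and "integrable leb u"
proof -
  have [measurable]: "u \<in> borel_measurable leb" "q \<in> borel_measurable leb"
    using u exponent_measurable by (auto simp: modular_ball_def)
  have "(\<integral>\<^sup>+x. ennreal \<bar>u x\<bar> \<partial>leb) \<le> ennreal (measure leb \<Omega> + max 0 K)"
  proof (rule nn_integral_le_of_le_one_plus)
    show "(\<lambda>x. ennreal (\<bar>u x\<bar> powr q x)) \<in> borel_measurable leb" by measurable
    show "(\<integral>\<^sup>+x. ennreal (\<bar>u x\<bar> powr q x) \<partial>leb) \<le> ennreal K"
      using u by (simp add: modular_ball_def)
    show "ennreal \<bar>u x\<bar> \<le> 1 + ennreal (\<bar>u x\<bar> powr q x)" if "x \<in> \<Omega>" for x
    proof -
      have "\<bar>u x\<bar> powr 1 \<le> 1 + \<bar>u x\<bar> powr q x"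
        using q_bounds[OF in_closure[OF that]] sigma_gt_1 by (intro powr_le_one_plus) auto
      from ennreal_leI[OF this] show ?thesis by simp
    qed
  qed
  then show *: "(\<integral>\<^sup>+x. ennreal \<bar>u x\<bar> \<partial>leb) \<le> ennreal (measure leb \<Omega> + K)"
    using K by (simp add: max_def)
  then show "integrable leb u"
    by (intro integrableI_bounded) (auto intro: le_less_trans)
qed

text \<open>This is uniform integrability: as \<open>q \<ge> \<sigma> > 1\<close>, the part of \<open>\<bar>z\<bar>\<close> above a large level \<open>T\<close>
  is a small multiple of \<open>\<bar>z\<bar> powr q x\<close>.\<close>

lemma le_cutoff_plus_powr:
  assumes x: "x \<in> \<Omega>" and T: "1 \<le> T"
  shows "\<bar>z\<bar> \<le> T + T powr (1 - \<sigma>) * \<bar>z\<bar> powr q x"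
proof (cases "\<bar>z\<bar> \<le> T")
  case False
  have q: "\<sigma> \<le> q x" using q_bounds in_closure[OF x] by blast
  have "\<bar>z\<bar> = \<bar>z\<bar> powr (1 - q x) * \<bar>z\<bar> powr q x"
    using False T by (simp flip: powr_add)
  also have "\<bar>z\<bar> powr (1 - q x) \<le> T powr (1 - q x)"
    using False T q sigma_gt_1 by (intro powr_mono2') auto
  also have "T powr (1 - q x) \<le> T powr (1 - \<sigma>)"
    using T q by (intro powr_mono) auto
  finally show ?thesis using T by (simp add: mult_right_mono)
qed (simp add: add_increasing2)

text \<open>For countable dense \<open>D\<close> this is a countable family, and its members with radius at most \<open>h\<close> still cover the domain
  for each \<open>h > 0\<close>.\<close>

definition small_balls :: "'a set \<Rightarrow> real \<Rightarrow> 'a set set" where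
  "small_balls D h = {ball z (1 / real (Suc n)) | z n. z \<in> D \<and> 1 / real (Suc n) \<le> h \<and>
     ball z (1 / real (Suc n)) \<subseteq> \<Omega>}"

lemma small_balls_mono: "h \<le> h' \<Longrightarrow> small_balls D h \<subseteq> small_balls D h'"
  unfolding small_balls_def by (blast intro: order_trans)

lemma countable_small_balls:
  assumes "countable D"
  shows "countable (small_balls D h)"
proof (rule countable_subset)
  show "small_balls D h \<subseteq> (\<lambda>(z, n). ball z (1 / real (Suc n))) ` (D \<times> UNIV)"
    unfolding small_balls_def by blast
qed (use assms in auto)

lemma small_balls_cover:
  assumes D: "\<And>X :: 'a set. open X \<Longrightarrow> X \<noteq> {} \<Longrightarrow> \<exists>d\<in>D. d \<in> X" and h: "0 < h"
  shows "\<Omega> \<subseteq> \<Union> (small_balls D h)"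
proof
  fix x assume "x \<in> \<Omega>"
  then obtain e where e: "0 < e" "ball x e \<subseteq> \<Omega>" using open_domain open_contains_ball by blast
  then obtain n where n: "1 / real (Suc n) < min h (e / 2)"
    using nat_approx_posE[of "min h (e / 2)"] h by auto
  define t where "t = 1 / real (Suc n)"
  have t: "0 < t" "t < h" "t < e / 2" using n by (auto simp: t_def)
  obtain z where z: "z \<in> D" "z \<in> ball x t"
    using D[of "ball x t"] t by auto
  have sub: "ball z t \<subseteq> ball x e"
  proof
    fix y assume "y \<in> ball z t"
    then show "y \<in> ball x e" using dist_triangle[of x y z] z t by simp
  qed
  have "ball z t \<in> small_balls D h"
    unfolding small_balls_def mem_Collect_eq
    by (rule exI[of _ z], rule exI[of _ n]) (use z e t sub in \<open>auto simp: t_def\<close>)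
  moreover have "x \<in> ball z t" using z by (simp add: dist_commute)
  ultimately show "x \<in> \<Union> (small_balls D h)" by blast
qed

text \<open>Inner regularity provides a compact subset of almost full measure, to which compactness applies.\<close>

lemma finite_cover_up_to_measure:
  assumes \<BB>: "\<Omega> \<subseteq> \<Union> \<BB>" "\<And>B. B \<in> \<BB> \<Longrightarrow> open B \<and> B \<subseteq> \<Omega>" and \<eta>: "0 < \<eta>"
  obtains \<FF> where "\<FF> \<subseteq> \<BB>" "finite \<FF>" "\<Omega> - \<Union>\<FF> \<in> sets leb" "measure leb (\<Omega> - \<Union>\<FF>) < \<eta>"
proof -
  obtain S where S: "closed S" "S \<subseteq> \<Omega>" "\<Omega> - S \<in> lmeasurable" "emeasure lebesgue (\<Omega> - S) < ennreal \<eta>"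
    using sets_lebesgue_inner_closed[of \<Omega> \<eta>] open_domain \<eta> by auto
  have "compact S" using S bounded_domain bounded_subset by (auto simp: compact_eq_bounded_closed)
  moreover have "S \<subseteq> \<Union>\<BB>" using S \<BB> by blast
  ultimately obtain \<FF> where \<FF>: "\<FF> \<subseteq> \<BB>" "finite \<FF>" "S \<subseteq> \<Union>\<FF>"
    using \<BB>(2) by (elim compactE) auto
  have "\<Union>\<FF> \<in> sets leb"
  proof (rule open_in_sets_leb)
    show "open (\<Union>\<FF>)" using \<FF> \<BB> by (intro open_Union) auto
    show "\<Union>\<FF> \<subseteq> \<Omega>" using \<FF> \<BB> by blast
  qed
  then have meas: "\<Omega> - \<Union>\<FF> \<in> sets leb" by auto
  have "emeasure leb (\<Omega> - \<Union>\<FF>) = emeasure lebesgue (\<Omega> - \<Union>\<FF>)" by (rule emeasure_leb[OF meas])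
  also have "\<dots> \<le> emeasure lebesgue (\<Omega> - S)"
    using \<FF> S by (intro emeasure_mono) auto
  also have "\<dots> < ennreal \<eta>" by (rule S)
  finally have "measure leb (\<Omega> - \<Union>\<FF>) < \<eta>"
    using \<eta> by (simp add: leb.emeasure_eq_measure ennreal_less_iff)
  then show ?thesis using that \<FF> meas by blast
qed

text \<open>On the balls of the finite family, \<open>u\<close> and \<open>v\<close> are compared with their means; on the remainder, which has small
  measure in the application, the cutoff at the level \<open>T\<close> is used.\<close>

lemma modular_ball_difference:
  assumes u: "u \<in> modular_ball K" and v: "v \<in> modular_ball K" and K: "0 \<le> K"
    and e: "0 \<le> e" and h: "0 < h" and T: "1 \<le> T"
    and \<FF>: "finite \<FF>" "\<FF> \<subseteq> small_balls D h"
    and means: "\<And>B. B \<in> \<FF> \<Longrightarrow>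
      \<bar>(LINT y|leb. indicator B y * u y) / measure lborel B
        - (LINT y|leb. indicator B y * v y) / measure lborel B\<bar> \<le> e"
    and meas: "\<Omega> - \<Union>\<FF> \<in> sets leb"
  shows "(\<integral>\<^sup>+x. ennreal \<bar>u x - v x\<bar> \<partial>leb)
     \<le> ennreal (e * measure leb \<Omega> + (2 * h) powr s * (2 * measure leb \<Omega> + 2 * ball_constant * K)
         + 2 * T * measure leb (\<Omega> - \<Union>\<FF>) + 2 * T powr (1 - \<sigma>) * K)"
proof -
  let ?U = "gagliardo_potential \<Omega> s p"
  define t where "t = (2 * h) powr s"
  have t: "0 < t" using h by (simp add: t_def)
  note c = ball_constant_pos
  have [measurable]: "u \<in> borel_measurable leb" "v \<in> borel_measurable leb" "q \<in> borel_measurable leb"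
    "\<Omega> - \<Union>\<FF> \<in> sets leb"
    using u v exponent_measurable meas by (auto simp: modular_ball_def)
  have [measurable]: "?U u \<in> borel_measurable leb" "?U v \<in> borel_measurable leb"
    by (auto intro: potential_measurable)
  have le: "ennreal \<bar>u x - v x\<bar> \<le> ennreal (e + 2 * t) + ennreal (t * ball_constant) * (?U u x + ?U v x)
      + (ennreal (2 * T) * indicator (\<Omega> - \<Union>\<FF>) x
        + ennreal (T powr (1 - \<sigma>)) * (ennreal (\<bar>u x\<bar> powr q x) + ennreal (\<bar>v x\<bar> powr q x)))"
    (is "_ \<le> ?R1 x + ?R2 x") if x: "x \<in> \<Omega>" for x
  proof (cases "x \<in> \<Union>\<FF>")
    case False
    have "\<bar>u x - v x\<bar> \<le> \<bar>u x\<bar> + \<bar>v x\<bar>" by simp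
    also have "\<dots> \<le> 2 * T + T powr (1 - \<sigma>) * (\<bar>u x\<bar> powr q x + \<bar>v x\<bar> powr q x)"
      using le_cutoff_plus_powr[OF x T, of "u x"] le_cutoff_plus_powr[OF x T, of "v x"]
      by (simp add: algebra_simps)
    finally have "ennreal \<bar>u x - v x\<bar> \<le> ennreal (2 * T + T powr (1 - \<sigma>) * (\<bar>u x\<bar> powr q x + \<bar>v x\<bar> powr q x))"
      by (rule ennreal_leI)
    also have "\<dots> = ?R2 x"
      using False x T by (simp add: ennreal_mult)
    also have "\<dots> \<le> ?R1 x + ?R2 x" by simp
    finally show ?thesis .
  next
    case True
    then obtain B where B: "B \<in> \<FF>" "x \<in> B" by blast
    obtain z n where zn: "B = ball z (1 / real (Suc n))" "1 / real (Suc n) \<le> h"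
        "ball z (1 / real (Suc n)) \<subseteq> \<Omega>"
      using subsetD[OF \<FF>(2) B(1)] unfolding small_balls_def mem_Collect_eq by blast
    define h' where "h' = 1 / real (Suc n)"
    have zh: "B = ball z h'" "0 < h'" "h' \<le> h" "ball z h' \<subseteq> \<Omega>"
      using zn by (auto simp: h'_def)
    show ?thesis
    proof (cases "?U u x = \<infinity> \<or> ?U v x = \<infinity>")
      case True
      then have "ennreal (t * ball_constant) * (?U u x + ?U v x) = \<infinity>"
        using t c by (auto simp: ennreal_mult_top)
      then show ?thesis by simp
    next
      case False
      then obtain a b where ab: "?U u x = ennreal a" "0 \<le> a" "?U v x = ennreal b" "0 \<le> b"
        by (cases "?U u x"; cases "?U v x") auto
      have ht: "(2 * h') powr s \<le> t" unfolding t_def using zh s_pos by (intro powr_mono2) auto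
      define au where "au = (LINT y|leb. indicator B y * u y) / measure lborel B"
      define av where "av = (LINT y|leb. indicator B y * v y) / measure lborel B"
      have "\<bar>u x - au\<bar> \<le> (2 * h') powr s * (1 + ball_constant * a)"
        unfolding au_def zh(1)
        using B zh ab by (intro ball_mean_oscillation modular_ball_L1(2)[OF u K]) auto
      also have "\<dots> \<le> t * (1 + ball_constant * a)"
        using ht c ab by (intro mult_right_mono) auto
      finally have 1: "\<bar>u x - au\<bar> \<le> t * (1 + ball_constant * a)" .
      have "\<bar>v x - av\<bar> \<le> (2 * h') powr s * (1 + ball_constant * b)"
        unfolding av_def zh(1)
        using B zh ab by (intro ball_mean_oscillation modular_ball_L1(2)[OF v K]) auto
      also have "\<dots> \<le> t * (1 + ball_constant * b)"
        using ht c ab by (intro mult_right_mono) auto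
      finally have 2: "\<bar>v x - av\<bar> \<le> t * (1 + ball_constant * b)" .
      have "\<bar>au - av\<bar> \<le> e" unfolding au_def av_def by (rule means[OF B(1)])
      with 1 2 have "\<bar>u x - v x\<bar> \<le> e + t * (1 + ball_constant * a) + t * (1 + ball_constant * b)"
        by linarith
      also have "\<dots> = (e + 2 * t) + (t * ball_constant) * (a + b)" by (simp add: algebra_simps)
      finally have "ennreal \<bar>u x - v x\<bar> \<le> ennreal ((e + 2 * t) + (t * ball_constant) * (a + b))"
        by (rule ennreal_leI)
      also have "\<dots> = ?R1 x" using ab e t c by (simp add: ennreal_mult)
      also have "\<dots> \<le> ?R1 x + ?R2 x" by simp
      finally show ?thesis .
    qed
  qed
  have "(\<integral>\<^sup>+x. ennreal \<bar>u x - v x\<bar> \<partial>leb) \<le> (\<integral>\<^sup>+x. ennreal (e + 2 * t) + ennreal (t * ball_constant) * (?U u x + ?U v x)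
      + (ennreal (2 * T) * indicator (\<Omega> - \<Union>\<FF>) x
        + ennreal (T powr (1 - \<sigma>)) * (ennreal (\<bar>u x\<bar> powr q x) + ennreal (\<bar>v x\<bar> powr q x))) \<partial>leb)"
    using le by (intro nn_integral_mono) auto
  also have "\<dots> = ennreal (e + 2 * t) * emeasure leb \<Omega>
      + ennreal (t * ball_constant) * (gagliardo_modular \<Omega> s p 1 u + gagliardo_modular \<Omega> s p 1 v)
      + (ennreal (2 * T) * emeasure leb (\<Omega> - \<Union>\<FF>)
        + ennreal (T powr (1 - \<sigma>)) * ((\<integral>\<^sup>+x. ennreal (\<bar>u x\<bar> powr q x) \<partial>leb)
            + (\<integral>\<^sup>+x. ennreal (\<bar>v x\<bar> powr q x) \<partial>leb)))"
    by (simp add: nn_integral_add nn_integral_cmult nn_integral_cmult_indicator gagliardo_modular_one)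
  also have "\<dots> \<le> ennreal (e + 2 * t) * ennreal (measure leb \<Omega>)
      + ennreal (t * ball_constant) * (ennreal K + ennreal K)
      + (ennreal (2 * T) * ennreal (measure leb (\<Omega> - \<Union>\<FF>))
        + ennreal (T powr (1 - \<sigma>)) * (ennreal K + ennreal K))"
    using u v unfolding modular_ball_def
    by (intro add_mono mult_left_mono) (auto simp: leb.emeasure_eq_measure)
  also have "\<dots> = ennreal ((e + 2 * t) * measure leb \<Omega> + t * ball_constant * (K + K)
      + (2 * T * measure leb (\<Omega> - \<Union>\<FF>) + T powr (1 - \<sigma>) * (K + K)))"
    using e t c K T by (simp add: ennreal_mult mult_2[symmetric, of "ennreal K"])
  also have "(e + 2 * t) * measure leb \<Omega> + t * ball_constant * (K + K)
      + (2 * T * measure leb (\<Omega> - \<Union>\<FF>) + T powr (1 - \<sigma>) * (K + K))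
      = e * measure leb \<Omega> + (2 * h) powr s * (2 * measure leb \<Omega> + 2 * ball_constant * K)
         + 2 * T * measure leb (\<Omega> - \<Union>\<FF>) + 2 * T powr (1 - \<sigma>) * K"
    by (simp add: t_def algebra_simps)
  finally show ?thesis .
qed

text \<open>A diagonal subsequence makes the integrals over all balls of the countable family converge. For given \<open>e\<close>,
  a small radius \<open>h\<close> controls the oscillation and a high level \<open>T\<close> the unbounded part; the measure left uncovered
  is then chosen in terms of \<open>T\<close>, and the indices are finally taken so large that the means over the
  finitely many balls in use are close.\<close>

lemma modular_ball_AE_Cauchy_subsequence:
  assumes f: "\<And>n. f n \<in> modular_ball K"
  obtains k :: "nat \<Rightarrow> nat" where "strict_mono k" "AE x in leb. Cauchy (\<lambda>n. f (k n) x)"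
proof -
  \<comment> \<open>A positive bound, by which the choice of \<open>T\<close> below divides.\<close>
  define K1 where "K1 = max 1 K"
  have K1: "0 < K1" and f1: "f n \<in> modular_ball K1" for n
    using f modular_ball_mono[of K K1] by (auto simp: K1_def)
  have K0: "0 \<le> K1" using K1 by simp
  obtain D :: "'a set" where D: "countable D" "\<And>X. open X \<Longrightarrow> X \<noteq> {} \<Longrightarrow> \<exists>d\<in>D. d \<in> X"
    by (rule countable_dense_setE) blast
  define I where "I = (\<lambda>n B. LINT y|leb. indicator B y * f n y)"
  have "norm (I n B) \<le> measure leb \<Omega> + K1" for n B
  proof (cases "integrable leb (\<lambda>y. indicator B y * f n y)")
    case True
    have "ennreal (norm (I n B)) \<le> (\<integral>\<^sup>+x. ennreal (norm (indicator B x * f n x)) \<partial>leb)"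
      unfolding I_def by (rule integral_norm_bound_ennreal[OF True])
    also have "\<dots> \<le> (\<integral>\<^sup>+x. ennreal \<bar>f n x\<bar> \<partial>leb)"
      by (intro nn_integral_mono ennreal_leI) (auto simp: indicator_def)
    also have "\<dots> \<le> ennreal (measure leb \<Omega> + K1)" by (rule modular_ball_L1(1)[OF f1 K0])
    finally show ?thesis using K1 by (subst (asm) ennreal_le_iff) auto
  next
    case False
    then show ?thesis using K1 by (simp add: I_def not_integrable_integral_eq)
  qed
  then obtain k1 :: "nat \<Rightarrow> nat" where k1: "strict_mono k1"
    and conv: "\<And>B. B \<in> small_balls D 1 \<Longrightarrow> \<exists>l. (\<lambda>n. I (k1 n) B) \<longlonglongrightarrow> l"
    using function_convergent_subsequence[OF countable_small_balls[OF D(1), of 1], of I "measure leb \<Omega> + K1"]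
    by blast
  define g where "g = (\<lambda>n. f (k1 n))"
  have g: "g n \<in> modular_ball K1" for n using f1 by (simp add: g_def)
  have int: "integrable leb (g n)" for n by (rule modular_ball_L1(2)[OF g K0])
  have "\<exists>N. \<forall>i\<ge>N. \<forall>j\<ge>N. LINT x|leb. norm (g i x - g j x) < e" if e: "0 < e" for e
  proof -
    define \<mu> where "\<mu> = measure leb \<Omega>"
    have \<mu>: "0 \<le> \<mu>" by (simp add: \<mu>_def)
    \<comment> \<open>Each of the four terms in the estimate of the distance is made smaller than \<open>e / 4\<close>.\<close>
    define e1 where "e1 = e / (5 * (\<mu> + 1))"
    have e1: "0 < e1" "e1 * \<mu> < e / 4"
      using e \<mu> by (auto simp: e1_def field_simps intro!: add_nonneg_pos)
    define H where "H = 2 * \<mu> + 2 * ball_constant * K1"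
    have H: "0 < H" using \<mu> K1 ball_constant_pos by (simp add: H_def add_nonneg_pos)
    define h where "h = min 1 ((e / (5 * H)) powr (1 / s) / 2)"
    have h: "0 < h" "h \<le> 1" using e H by (auto simp: h_def)
    have "(2 * h) powr s \<le> ((e / (5 * H)) powr (1 / s)) powr s"
      using h s_pos by (intro powr_mono2) (auto simp: h_def)
    also have "\<dots> = e / (5 * H)" using s_pos e H by (simp add: powr_powr)
    finally have "(2 * h) powr s * H \<le> e / (5 * H) * H" using H by (intro mult_right_mono) auto
    then have hH: "(2 * h) powr s * H < e / 4" using H e by simp
    have "((\<lambda>T. T powr (1 - \<sigma>)) \<longlongrightarrow> 0) at_top"
      using sigma_gt_1 by (intro tendsto_neg_powr filterlim_ident) auto
    then have "eventually (\<lambda>T. T powr (1 - \<sigma>) < e / (8 * K1)) at_top"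
      using e K1 by (intro order_tendstoD(2)) auto
    then have "eventually (\<lambda>T. T powr (1 - \<sigma>) < e / (8 * K1) \<and> 1 \<le> T) at_top"
      using eventually_ge_at_top[of 1] by eventually_elim auto
    then obtain T where T: "T powr (1 - \<sigma>) < e / (8 * K1)" "1 \<le> T"
      by (auto simp: eventually_at_top_linorder)
    have TK: "2 * T powr (1 - \<sigma>) * K1 < e / 4" using T K1 by (simp add: field_simps)
    have "0 < e / (8 * T)" using T e by simp
    moreover have "open B \<and> B \<subseteq> \<Omega>" if "B \<in> small_balls D h" for B
      using that by (auto simp: small_balls_def)
    ultimately obtain \<FF> where \<FF>: "\<FF> \<subseteq> small_balls D h" "finite \<FF>" "\<Omega> - \<Union>\<FF> \<in> sets leb"
      "measure leb (\<Omega> - \<Union>\<FF>) < e / (8 * T)"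
      using finite_cover_up_to_measure[OF small_balls_cover[OF D(2) h(1)]] by metis
    have T\<eta>: "2 * T * measure leb (\<Omega> - \<Union>\<FF>) < e / 4" using \<FF>(4) T by (simp add: field_simps)
    have "\<FF> \<subseteq> small_balls D 1" using \<FF>(1) small_balls_mono[OF h(2)] by (rule subset_trans)
    have "\<exists>N. \<forall>i\<ge>N. \<forall>j\<ge>N. \<bar>I (k1 i) B / measure lborel B - I (k1 j) B / measure lborel B\<bar> < e1"
      if B: "B \<in> \<FF>" for B
    proof -
      obtain l where "(\<lambda>n. I (k1 n) B) \<longlonglongrightarrow> l" using conv B \<open>\<FF> \<subseteq> small_balls D 1\<close> by blast
      then have "(\<lambda>n. I (k1 n) B / measure lborel B) \<longlonglongrightarrow> l / measure lborel B"
        unfolding divide_inverse by (intro tendsto_mult_right)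
      then have "Cauchy (\<lambda>n. I (k1 n) B / measure lborel B)" by (rule LIMSEQ_imp_Cauchy)
      then show ?thesis using e1 unfolding Cauchy_def dist_real_def by blast
    qed
    then obtain N where N: "\<And>B i j. B \<in> \<FF> \<Longrightarrow> N B \<le> i \<Longrightarrow> N B \<le> j \<Longrightarrow>
      \<bar>I (k1 i) B / measure lborel B - I (k1 j) B / measure lborel B\<bar> < e1"
      by metis
    have "LINT x|leb. norm (g i x - g j x) < e" if ij: "Max (insert 0 (N ` \<FF>)) \<le> i" "Max (insert 0 (N ` \<FF>)) \<le> j" for i j
    proof -
      have NB: "N B \<le> Max (insert 0 (N ` \<FF>))" if "B \<in> \<FF>" for B
        using \<FF>(2) that by (intro Max_ge) auto
      have "(\<integral>\<^sup>+x. ennreal \<bar>g i x - g j x\<bar> \<partial>leb) \<le> ennreal (e1 * measure leb \<Omega>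
         + (2 * h) powr s * (2 * measure leb \<Omega> + 2 * ball_constant * K1)
         + 2 * T * measure leb (\<Omega> - \<Union>\<FF>) + 2 * T powr (1 - \<sigma>) * K1)"
      proof (rule modular_ball_difference[OF g g K0 less_imp_le[OF e1(1)] h(1) T(2) \<FF>(2,1) _ \<FF>(3)])
        fix B assume B: "B \<in> \<FF>"
        show "\<bar>(LINT y|leb. indicator B y * g i y) / measure lborel B
          - (LINT y|leb. indicator B y * g j y) / measure lborel B\<bar> \<le> e1"
          using N[OF B, of i j] NB[OF B] ij by (simp add: I_def g_def)
      qed
      moreover have "(\<integral>\<^sup>+x. ennreal \<bar>g i x - g j x\<bar> \<partial>leb) = ennreal (LINT x|leb. norm (g i x - g j x))"
        using int by (subst nn_integral_eq_integral) auto
      ultimately have "ennreal (LINT x|leb. norm (g i x - g j x)) \<le> ennreal (e1 * \<mu>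
         + (2 * h) powr s * H + 2 * T * measure leb (\<Omega> - \<Union>\<FF>) + 2 * T powr (1 - \<sigma>) * K1)"
        by (simp only: \<mu>_def H_def)
      moreover have "0 \<le> e1 * \<mu> + (2 * h) powr s * H + 2 * T * measure leb (\<Omega> - \<Union>\<FF>)
          + 2 * T powr (1 - \<sigma>) * K1"
        using e1 \<mu> H K1 T by (intro add_nonneg_nonneg mult_nonneg_nonneg) auto
      ultimately have "(LINT x|leb. norm (g i x - g j x)) \<le> e1 * \<mu> + (2 * h) powr s * H
         + 2 * T * measure leb (\<Omega> - \<Union>\<FF>) + 2 * T powr (1 - \<sigma>) * K1"
        by (subst (asm) ennreal_le_iff)
      then show ?thesis using e1 hH T\<eta> TK by linarith
    qed
    then show ?thesis by blast
  qed
  then obtain k2 where "strict_mono k2" "AE x in leb. Cauchy (\<lambda>i. g (k2 i) x)"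
    using cauchy_L1_AE_cauchy_subseq[of leb g] int by blast
  then show ?thesis
    using k1 by (intro that[of "k1 \<circ> k2"]) (auto simp: g_def strict_mono_o)
qed

section \<open>Norms and modulars\<close>

lemma luxemburg_norm_le:
  assumes "0 < l" "(\<integral>\<^sup>+x. ennreal (\<bar>u x / l\<bar> powr h x) \<partial>lebesgue_on \<Omega>) \<le> 1"
  shows "luxemburg_norm \<Omega> h u \<le> l"
  unfolding luxemburg_norm_def using assms by (intro cInf_lower bdd_belowI[of _ 0]) auto

lemma nn_integral_le_cmult:
  assumes "b \<in> borel_measurable leb" "0 \<le> c" "\<And>x. x \<in> \<Omega> \<Longrightarrow> a x \<le> c * b x"
  shows "(\<integral>\<^sup>+x. ennreal (a x) \<partial>leb) \<le> ennreal c * (\<integral>\<^sup>+x. ennreal (b x) \<partial>leb)"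
proof -
  have "(\<integral>\<^sup>+x. ennreal (a x) \<partial>leb) \<le> (\<integral>\<^sup>+x. ennreal c * ennreal (b x) \<partial>leb)"
    using assms by (intro nn_integral_mono) (auto simp: ennreal_mult'[symmetric] intro!: ennreal_leI)
  also have "\<dots> = ennreal c * (\<integral>\<^sup>+x. ennreal (b x) \<partial>leb)"
    using assms by (intro nn_integral_cmult) auto
  finally show ?thesis .
qed

lemma gagliardo_modular_le_cmult:
  assumes u: "u \<in> borel_measurable leb" and c: "0 \<le> c"
    and le: "\<And>x y. x \<in> \<Omega> \<Longrightarrow> y \<in> \<Omega> \<Longrightarrow> \<bar>w x - w y\<bar> powr p (x, y) \<le> c * \<bar>u x - u y\<bar> powr p (x, y)"
  shows "gagliardo_modular \<Omega> s p 1 w \<le> ennreal c * gagliardo_modular \<Omega> s p 1 u"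
proof -
  have "gagliardo_potential \<Omega> s p w y \<le> ennreal c * gagliardo_potential \<Omega> s p u y" if "y \<in> \<Omega>" for y
    unfolding gagliardo_potential_def
  proof (rule nn_integral_le_cmult[OF quotient_measurable[OF u that] c])
    show "gagliardo_quotient s p w x y \<le> c * gagliardo_quotient s p u x y" if "x \<in> \<Omega>" for x
      using divide_right_mono[OF le[OF that \<open>y \<in> \<Omega>\<close>]] by (simp add: gagliardo_quotient_def)
  qed
  then have "gagliardo_modular \<Omega> s p 1 w \<le> (\<integral>\<^sup>+y. ennreal c * gagliardo_potential \<Omega> s p u y \<partial>leb)"
    unfolding gagliardo_modular_one by (intro nn_integral_mono) auto
  also have "\<dots> = ennreal c * gagliardo_modular \<Omega> s p 1 u"
    unfolding gagliardo_modular_one by (intro nn_integral_cmult potential_measurable u)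
  finally show ?thesis .
qed

lemma power_measurable:
  fixes u h :: "'a \<Rightarrow> real"
  assumes "u \<in> borel_measurable leb" "continuous_on (closure \<Omega>) h"
  shows "(\<lambda>x. \<bar>u x\<bar> powr h x) \<in> borel_measurable leb"
  using assms(1) continuous_imp_measurable[OF assms(2)] by measurable

text \<open>As the infimum of the empty set of reals is an unspecified number, the Luxemburg norm has a meaning only if some
  admissible \<open>l\<close> exists.\<close>

lemma luxemburg_set_nonempty:
  assumes u: "u \<in> lebesgue_space \<Omega> h" and h: "continuous_on (closure \<Omega>) h"
    and h1: "\<And>x. x \<in> \<Omega> \<Longrightarrow> 1 \<le> h x"
  shows "\<exists>l>0. (\<integral>\<^sup>+x. ennreal (\<bar>u x / l\<bar> powr h x) \<partial>leb) \<le> 1"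
proof -
  have um: "u \<in> borel_measurable leb" using u by (simp add: lebesgue_space_def)
  obtain A where A: "(\<integral>\<^sup>+x. ennreal (\<bar>u x\<bar> powr h x) \<partial>leb) = ennreal A" "0 \<le> A"
    using u by (cases "\<integral>\<^sup>+x. ennreal (\<bar>u x\<bar> powr h x) \<partial>leb") (auto simp: lebesgue_space_def)
  have "(\<integral>\<^sup>+x. ennreal (\<bar>u x / (A + 1)\<bar> powr h x) \<partial>leb)
      \<le> ennreal (1 / (A + 1)) * (\<integral>\<^sup>+x. ennreal (\<bar>u x\<bar> powr h x) \<partial>leb)"
    using A h1 scaled_powr_le[of "1 / (A + 1)"]
    by (intro nn_integral_le_cmult power_measurable um h) auto
  also have "\<dots> \<le> 1"
    using A by (simp add: ennreal_mult[symmetric] field_simps)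
  finally show ?thesis using A by (intro exI[of _ "A + 1"]) auto
qed

lemma luxemburg_norm_nonneg:
  assumes "u \<in> lebesgue_space \<Omega> h" "continuous_on (closure \<Omega>) h" "\<And>x. x \<in> \<Omega> \<Longrightarrow> 1 \<le> h x"
  shows "0 \<le> luxemburg_norm \<Omega> h u"
  unfolding luxemburg_norm_def
  using luxemburg_set_nonempty[OF assms] by (intro cInf_greatest) auto

lemma luxemburg_norm_lessD:
  assumes u: "u \<in> lebesgue_space \<Omega> h" "continuous_on (closure \<Omega>) h" "\<And>x. x \<in> \<Omega> \<Longrightarrow> 1 \<le> h x"
    and less: "luxemburg_norm \<Omega> h u < l"
  shows "(\<integral>\<^sup>+x. ennreal (\<bar>u x / l\<bar> powr h x) \<partial>leb) \<le> 1"
proof -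
  obtain l' where l': "0 < l'" "l' < l" "(\<integral>\<^sup>+x. ennreal (\<bar>u x / l'\<bar> powr h x) \<partial>leb) \<le> 1"
    using cInf_lessD[OF _ less[unfolded luxemburg_norm_def]] luxemburg_set_nonempty[OF u] by blast
  have "(\<integral>\<^sup>+x. ennreal (\<bar>u x / l\<bar> powr h x) \<partial>leb) \<le> (\<integral>\<^sup>+x. ennreal (\<bar>u x / l'\<bar> powr h x) \<partial>leb)"
  proof (intro nn_integral_mono ennreal_leI powr_mono2)
    fix x assume "x \<in> space leb"
    then show "0 \<le> h x" using u(3)[of x] by simp
    show "\<bar>u x / l\<bar> \<le> \<bar>u x / l'\<bar>" using l' by (simp add: abs_div_pos[symmetric] frac_le)
  qed auto
  with l' show ?thesis by simp
qed

lemma gagliardo_set_nonempty: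
  assumes u: "u \<in> fractional_sobolev_space \<Omega> s q p"
  shows "\<exists>l>0. gagliardo_modular \<Omega> s p l u < 1"
proof -
  have um: "u \<in> borel_measurable leb"
    using u by (simp add: fractional_sobolev_space_def lebesgue_space_def)
  obtain A where A: "gagliardo_modular \<Omega> s p 1 u = ennreal A" "0 \<le> A"
    using u by (cases "gagliardo_modular \<Omega> s p 1 u") (auto simp: fractional_sobolev_space_def)
  have "gagliardo_modular \<Omega> s p (A + 1) u = gagliardo_modular \<Omega> s p 1 (\<lambda>x. u x / (A + 1))"
    using A by (intro gagliardo_modular_scale) auto
  also have "\<dots> \<le> ennreal (1 / (A + 1)) * gagliardo_modular \<Omega> s p 1 u"
  proof (intro gagliardo_modular_le_cmult um)
    fix x y assume "x \<in> \<Omega>" "y \<in> \<Omega>"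
    then show "\<bar>u x / (A + 1) - u y / (A + 1)\<bar> powr p (x, y) \<le> 1 / (A + 1) * \<bar>u x - u y\<bar> powr p (x, y)"
      using scaled_powr_le[of "1 / (A + 1)" "p (x, y)" "u x - u y"] A p_bounds in_closure
      by (simp flip: diff_divide_distrib)
  qed (use A in auto)
  also have "\<dots> < 1"
    using A by (simp add: ennreal_mult[symmetric] ennreal_less_one_iff)
  finally show ?thesis using A by (intro exI[of _ "A + 1"]) auto
qed

lemma gagliardo_seminorm_nonneg:
  assumes "u \<in> fractional_sobolev_space \<Omega> s q p"
  shows "0 \<le> gagliardo_seminorm \<Omega> s p u"
  unfolding gagliardo_seminorm_def
  using gagliardo_set_nonempty[OF assms] by (intro cInf_greatest) auto

lemma gagliardo_seminorm_lessD:
  assumes u: "u \<in> fractional_sobolev_space \<Omega> s q p" and less: "gagliardo_seminorm \<Omega> s p u < l"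
  shows "gagliardo_modular \<Omega> s p 1 (\<lambda>x. u x / l) \<le> 1"
proof -
  have um: "u \<in> borel_measurable leb"
    using u by (simp add: fractional_sobolev_space_def lebesgue_space_def)
  obtain l' where l': "0 < l'" "l' < l" "gagliardo_modular \<Omega> s p l' u < 1"
    using cInf_lessD[OF _ less[unfolded gagliardo_seminorm_def]] gagliardo_set_nonempty[OF u] by blast
  have "gagliardo_modular \<Omega> s p 1 (\<lambda>x. u x / l)
      \<le> ennreal 1 * gagliardo_modular \<Omega> s p 1 (\<lambda>x. u x / l')"
  proof (intro gagliardo_modular_le_cmult)
    fix x y assume "x \<in> \<Omega>" "y \<in> \<Omega>"
    then have "0 \<le> p (x, y)" using p_bounds[of x y] in_closure by auto
    moreover have "\<bar>(u x - u y) / l\<bar> \<le> \<bar>(u x - u y) / l'\<bar>"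
      using l' by (simp add: abs_div_pos[symmetric] frac_le)
    ultimately show "\<bar>u x / l - u y / l\<bar> powr p (x, y) \<le> 1 * \<bar>u x / l' - u y / l'\<bar> powr p (x, y)"
      by (simp add: powr_mono2 flip: diff_divide_distrib)
  qed (use um in auto)
  then show ?thesis using l' gagliardo_modular_scale[of l' \<Omega> s p u] by simp
qed

lemma q_ge_1: "x \<in> \<Omega> \<Longrightarrow> 1 \<le> q x"
  using q_bounds[of x] sigma_gt_1 in_closure[of x] by auto

text \<open>Both parts of the norm are nonnegative, so each of them is below \<open>l\<close>.\<close>

lemma fractional_sobolev_norm_lessD:
  assumes u: "u \<in> fractional_sobolev_space \<Omega> s q p" and less: "fractional_sobolev_norm \<Omega> s q p u < l"
  shows "(\<lambda>x. u x / l) \<in> modular_ball 1"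
proof -
  have uL: "u \<in> lebesgue_space \<Omega> q" and um: "u \<in> borel_measurable leb"
    using u by (simp_all add: fractional_sobolev_space_def lebesgue_space_def)
  have "luxemburg_norm \<Omega> q u < l" "gagliardo_seminorm \<Omega> s p u < l"
    using less luxemburg_norm_nonneg[OF uL q_continuous q_ge_1] gagliardo_seminorm_nonneg[OF u]
    by (auto simp: fractional_sobolev_norm_def)
  then show ?thesis
    using luxemburg_norm_lessD[OF uL q_continuous q_ge_1] gagliardo_seminorm_lessD[OF u] um
    by (simp add: modular_ball_def)
qed

lemma fractional_sobolev_space_iff:
  "u \<in> fractional_sobolev_space \<Omega> s q p \<longleftrightarrow> (\<exists>K\<ge>0. u \<in> modular_ball K)"
proof
  assume u: "u \<in> fractional_sobolev_space \<Omega> s q p"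
  define A where "A = enn2real (\<integral>\<^sup>+x. ennreal (\<bar>u x\<bar> powr q x) \<partial>leb)"
  define B where "B = enn2real (gagliardo_modular \<Omega> s p 1 u)"
  have A: "(\<integral>\<^sup>+x. ennreal (\<bar>u x\<bar> powr q x) \<partial>leb) = ennreal A" "0 \<le> A"
    and B: "gagliardo_modular \<Omega> s p 1 u = ennreal B" "0 \<le> B"
    using u by (auto simp: A_def B_def fractional_sobolev_space_def lebesgue_space_def less_top)
  then have "u \<in> modular_ball (max A B)"
    using u by (auto simp: modular_ball_def fractional_sobolev_space_def lebesgue_space_def
        intro: ennreal_leI)
  then show "\<exists>K\<ge>0. u \<in> modular_ball K" using A by (intro exI[of _ "max A B"]) auto
next
  assume "\<exists>K\<ge>0. u \<in> modular_ball K"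
  then show "u \<in> fractional_sobolev_space \<Omega> s q p"
    by (auto simp: modular_ball_def fractional_sobolev_space_def lebesgue_space_def
        intro: le_less_trans)
qed

lemma modular_ball_dilate:
  assumes u: "u \<in> modular_ball K" and K: "0 \<le> K" and l: "1 \<le> l"
  shows "(\<lambda>x. l * u x) \<in> modular_ball (l powr max P Q * K)"
proof -
  have um: "u \<in> borel_measurable leb" and uq: "(\<integral>\<^sup>+x. ennreal (\<bar>u x\<bar> powr q x) \<partial>leb) \<le> ennreal K"
    and ug: "gagliardo_modular \<Omega> s p 1 u \<le> ennreal K"
    using u by (auto simp: modular_ball_def)
  have E: "0 \<le> l powr max P Q" by simp
  have "(\<integral>\<^sup>+x. ennreal (\<bar>l * u x\<bar> powr q x) \<partial>leb)
      \<le> ennreal (l powr max P Q) * (\<integral>\<^sup>+x. ennreal (\<bar>u x\<bar> powr q x) \<partial>leb)"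
  proof (intro nn_integral_le_cmult power_measurable um q_continuous E)
    fix x assume "x \<in> \<Omega>"
    then show "\<bar>l * u x\<bar> powr q x \<le> l powr max P Q * \<bar>u x\<bar> powr q x"
      using l q_ge_1[of x] q_bounds[of x] in_closure[of x] by (intro dilated_powr_le) auto
  qed
  also have "\<dots> \<le> ennreal (l powr max P Q) * ennreal K" using uq by (intro mult_left_mono) auto
  finally have 1: "(\<integral>\<^sup>+x. ennreal (\<bar>l * u x\<bar> powr q x) \<partial>leb) \<le> ennreal (l powr max P Q * K)"
    using K by (simp add: ennreal_mult)
  have "gagliardo_modular \<Omega> s p 1 (\<lambda>x. l * u x) \<le> ennreal (l powr max P Q) * gagliardo_modular \<Omega> s p 1 u"
  proof (intro gagliardo_modular_le_cmult um E)
    fix x y assume "x \<in> \<Omega>" "y \<in> \<Omega>"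
    then show "\<bar>l * u x - l * u y\<bar> powr p (x, y) \<le> l powr max P Q * \<bar>u x - u y\<bar> powr p (x, y)"
      using dilated_powr_le[of l "p (x, y)" "max P Q" "u x - u y"] l p_bounds[of x y] in_closure
      by (auto simp: right_diff_distrib)
  qed
  also have "\<dots> \<le> ennreal (l powr max P Q) * ennreal K" using ug by (intro mult_left_mono) auto
  finally have 2: "gagliardo_modular \<Omega> s p 1 (\<lambda>x. l * u x) \<le> ennreal (l powr max P Q * K)"
    using K by (simp add: ennreal_mult)
  show ?thesis using 1 2 um by (simp add: modular_ball_def)
qed

lemma difference_power_bound:
  assumes u: "u \<in> borel_measurable leb" and v: "v \<in> borel_measurable leb"
    and h: "continuous_on (closure \<Omega>) h" "\<And>x. x \<in> \<Omega> \<Longrightarrow> 1 \<le> h x \<and> h x \<le> H"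
    and C: "0 \<le> C" "(\<integral>\<^sup>+x. ennreal (\<bar>u x\<bar> powr h x) \<partial>leb) \<le> ennreal C"
      "(\<integral>\<^sup>+x. ennreal (\<bar>v x\<bar> powr h x) \<partial>leb) \<le> ennreal C"
  shows "(\<integral>\<^sup>+x. ennreal (\<bar>u x - v x\<bar> powr h x) \<partial>leb) \<le> ennreal (2 powr H * (2 * C))"
proof -
  have [measurable]: "u \<in> borel_measurable leb" "v \<in> borel_measurable leb" "h \<in> borel_measurable leb"
    using u v continuous_imp_measurable[OF h(1)] by auto
  have "(\<integral>\<^sup>+x. ennreal (\<bar>u x - v x\<bar> powr h x) \<partial>leb)
      \<le> ennreal (2 powr H) * (\<integral>\<^sup>+x. ennreal (\<bar>u x\<bar> powr h x + \<bar>v x\<bar> powr h x) \<partial>leb)"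
  proof (intro nn_integral_le_cmult)
    fix x assume "x \<in> \<Omega>"
    then show "\<bar>u x - v x\<bar> powr h x \<le> 2 powr H * (\<bar>u x\<bar> powr h x + \<bar>v x\<bar> powr h x)"
      using h(2)[of x] by (intro abs_diff_powr_le) auto
  next
    show "(\<lambda>x. \<bar>u x\<bar> powr h x + \<bar>v x\<bar> powr h x) \<in> borel_measurable leb" by measurable
  qed simp
  also have "\<dots> \<le> ennreal (2 powr H) * (ennreal C + ennreal C)"
    using C by (intro mult_left_mono) (auto simp: nn_integral_add intro!: add_mono)
  also have "\<dots> = ennreal (2 powr H * (2 * C))"
    using C by (simp add: ennreal_mult mult_2[symmetric, of "ennreal C"])
  finally show ?thesis .
qed

lemma modular_ball_diff:
  assumes u: "u \<in> modular_ball K" and v: "v \<in> modular_ball K" and K: "0 \<le> K"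
  shows "(\<lambda>x. u x - v x) \<in> modular_ball (2 powr max P Q * (2 * K))"
proof -
  have [measurable]: "u \<in> borel_measurable leb" "v \<in> borel_measurable leb" "q \<in> borel_measurable leb"
    using u v exponent_measurable by (auto simp: modular_ball_def)
  let ?c = "2 powr max P Q"
  have [measurable]: "gagliardo_potential \<Omega> s p u \<in> borel_measurable leb"
    "gagliardo_potential \<Omega> s p v \<in> borel_measurable leb"
    by (auto intro: potential_measurable)
  have KK: "ennreal ?c * (ennreal K + ennreal K) = ennreal (?c * (2 * K))"
    using K by (simp add: ennreal_mult mult_2[symmetric, of "ennreal K"])
  have 1: "(\<integral>\<^sup>+x. ennreal (\<bar>u x - v x\<bar> powr q x) \<partial>leb) \<le> ennreal (?c * (2 * K))"
  proof (intro difference_power_bound q_continuous K)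
    show "1 \<le> q x \<and> q x \<le> max P Q" if "x \<in> \<Omega>" for x
      using q_ge_1[OF that] q_bounds[OF in_closure[OF that]] by auto
  qed (use u v in \<open>auto simp: modular_ball_def\<close>)
  have "gagliardo_potential \<Omega> s p (\<lambda>x. u x - v x) y
      \<le> ennreal ?c * (gagliardo_potential \<Omega> s p u y + gagliardo_potential \<Omega> s p v y)" if y: "y \<in> \<Omega>" for y
  proof -
    have [measurable]: "(\<lambda>x. gagliardo_quotient s p u x y) \<in> borel_measurable leb"
      "(\<lambda>x. gagliardo_quotient s p v x y) \<in> borel_measurable leb"
      using y by (auto intro: quotient_measurable)
    have "gagliardo_potential \<Omega> s p (\<lambda>x. u x - v x) y
        \<le> ennreal ?c * (\<integral>\<^sup>+x. ennreal (gagliardo_quotient s p u x y + gagliardo_quotient s p v x y) \<partial>leb)"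
      unfolding gagliardo_potential_def
    proof (intro nn_integral_le_cmult)
      fix x assume x: "x \<in> \<Omega>"
      have "\<bar>(u x - u y) - (v x - v y)\<bar> powr p (x, y)
          \<le> ?c * (\<bar>u x - u y\<bar> powr p (x, y) + \<bar>v x - v y\<bar> powr p (x, y))"
        using p_bounds[of x y] in_closure x y by (intro abs_diff_powr_le) auto
      also have "(u x - u y) - (v x - v y) = (u x - v x) - (u y - v y)" by simp
      finally show "gagliardo_quotient s p (\<lambda>x. u x - v x) x y
          \<le> ?c * (gagliardo_quotient s p u x y + gagliardo_quotient s p v x y)"
        unfolding gagliardo_quotient_def add_divide_distrib[symmetric] times_divide_eq_right
        by (rule divide_right_mono) simp
    next
      show "(\<lambda>x. gagliardo_quotient s p u x y + gagliardo_quotient s p v x y) \<in> borel_measurable leb"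
        by measurable
    qed simp
    then show ?thesis
      by (simp add: gagliardo_potential_def gagliardo_quotient_nonneg nn_integral_add)
  qed
  then have "gagliardo_modular \<Omega> s p 1 (\<lambda>x. u x - v x)
      \<le> (\<integral>\<^sup>+y. ennreal ?c * (gagliardo_potential \<Omega> s p u y + gagliardo_potential \<Omega> s p v y) \<partial>leb)"
    unfolding gagliardo_modular_one by (intro nn_integral_mono) auto
  also have "\<dots> = ennreal ?c * (gagliardo_modular \<Omega> s p 1 u + gagliardo_modular \<Omega> s p 1 v)"
    by (simp add: gagliardo_modular_one nn_integral_cmult nn_integral_add)
  also have "\<dots> \<le> ennreal ?c * (ennreal K + ennreal K)"
    using u v by (intro mult_left_mono) (auto simp: modular_ball_def intro!: add_mono)
  finally have 2: "gagliardo_modular \<Omega> s p 1 (\<lambda>x. u x - v x) \<le> ennreal (?c * (2 * K))"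
    unfolding KK .
  show ?thesis using 1 2 by (simp add: modular_ball_def)
qed

lemma fractional_sobolev_space_diff:
  assumes "u \<in> fractional_sobolev_space \<Omega> s q p" "v \<in> fractional_sobolev_space \<Omega> s q p"
  shows "(\<lambda>x. u x - v x) \<in> fractional_sobolev_space \<Omega> s q p"
proof -
  obtain K1 K2 where K: "0 \<le> K1" "u \<in> modular_ball K1" "0 \<le> K2" "v \<in> modular_ball K2"
    using assms by (auto simp: fractional_sobolev_space_iff)
  then have "u \<in> modular_ball (max K1 K2)" "v \<in> modular_ball (max K1 K2)"
    using modular_ball_mono[of K1 "max K1 K2"] modular_ball_mono[of K2 "max K1 K2"] by auto
  from modular_ball_diff[OF this] K show ?thesis
    unfolding fractional_sobolev_space_iff
    by (intro exI[of _ "2 powr max P Q * (2 * max K1 K2)"]) auto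
qed

lemma bounded_sequence_in_modular_ball:
  assumes f: "\<And>n. f n \<in> fractional_sobolev_space \<Omega> s q p"
    and C: "\<And>n. fractional_sobolev_norm \<Omega> s q p (f n) \<le> C"
  shows "\<exists>K. \<forall>n :: nat. f n \<in> modular_ball K"
proof -
  define l where "l = max 1 (C + 1)"
  have l: "1 \<le> l" "C < l" by (auto simp: l_def)
  have "f n \<in> modular_ball (l powr max P Q * 1)" for n
  proof -
    have "(\<lambda>x. f n x / l) \<in> modular_ball 1"
      using C[of n] l by (intro fractional_sobolev_norm_lessD f) auto
    from modular_ball_dilate[OF this _ l(1)] show ?thesis using l by simp
  qed
  then show ?thesis by blast
qed

section \<open>Convergence in the modular and in norm\<close>

text \<open>Truncation at a level \<open>T\<close>: the truncated powers converge by dominated convergence, since the measure is finite,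
  and the part above \<open>T\<close> costs at most \<open>T powr (- \<delta>) * C\<close>, uniformly in \<open>n\<close>.\<close>

lemma vitali_modular_convergence:
  assumes z: "\<And>n. z n \<in> borel_measurable leb" and z0: "\<And>n x. 0 \<le> (z n x :: real)"
    and lim: "AE x in leb. (\<lambda>n. z n x) \<longlonglongrightarrow> 0"
    and r: "continuous_on (closure \<Omega>) r" "\<And>x. x \<in> \<Omega> \<Longrightarrow> 1 \<le> r x \<and> r x \<le> R" and \<delta>: "0 < \<delta>"
    and C: "0 \<le> C" "\<And>n. (\<integral>\<^sup>+x. ennreal (z n x powr (r x + \<delta>)) \<partial>leb) \<le> ennreal C"
    and \<epsilon>: "0 < \<epsilon>"
  shows "eventually (\<lambda>n. (\<integral>\<^sup>+x. ennreal (z n x powr r x) \<partial>leb) < ennreal \<epsilon>) sequentially"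
proof -
  have [measurable]: "z n \<in> borel_measurable leb" for n by (rule z)
  have [measurable]: "r \<in> borel_measurable leb" by (rule continuous_imp_measurable[OF r(1)])
  have "((\<lambda>T. T powr (- \<delta>)) \<longlongrightarrow> 0) at_top"
    using \<delta> by (intro tendsto_neg_powr filterlim_ident) auto
  then have "eventually (\<lambda>T. T powr (- \<delta>) < \<epsilon> / (2 * (C + 1))) at_top"
    using \<epsilon> C by (intro order_tendstoD(2)) auto
  then have "eventually (\<lambda>T. T powr (- \<delta>) < \<epsilon> / (2 * (C + 1)) \<and> 1 \<le> T) at_top"
    using eventually_ge_at_top[of 1] by eventually_elim auto
  then obtain T where T: "T powr (- \<delta>) < \<epsilon> / (2 * (C + 1))" "1 \<le> T"
    by (auto simp: eventually_at_top_linorder)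
  have TC: "T powr (- \<delta>) * C \<le> \<epsilon> / 2"
  proof -
    have "0 < C + 1" using C by simp
    have "T powr (- \<delta>) * C \<le> \<epsilon> / (2 * (C + 1)) * (C + 1)" using T C \<epsilon> by (intro mult_mono) auto
    also have "\<dots> = \<epsilon> / 2" using \<open>0 < C + 1\<close> by (simp add: field_simps)
    finally show ?thesis .
  qed
  have "(\<lambda>n. \<integral>\<^sup>+x. ennreal (min (z n x) T powr r x) \<partial>leb) \<longlonglongrightarrow> (\<integral>\<^sup>+x. 0 \<partial>leb)"
  proof (rule nn_integral_dominated_convergence)
    show "AE x in leb. ennreal (min (z n x) T powr r x) \<le> ennreal (T powr R)" for n
    proof (rule AE_I2, rule ennreal_leI)
      fix x assume "x \<in> space leb"
      then have rx: "1 \<le> r x" "r x \<le> R" using r(2)[of x] by auto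
      have "min (z n x) T powr r x \<le> T powr r x" using rx z0 T by (intro powr_mono2) auto
      also have "\<dots> \<le> T powr R" using rx T by (intro powr_mono) auto
      finally show "min (z n x) T powr r x \<le> T powr R" .
    qed
    show "(\<integral>\<^sup>+x. ennreal (T powr R) \<partial>leb) < \<infinity>"
      by (simp add: leb.emeasure_eq_measure ennreal_mult_less_top)
    show "AE x in leb. (\<lambda>n. ennreal (min (z n x) T powr r x)) \<longlonglongrightarrow> 0"
      using lim AE_space
    proof eventually_elim
      case (elim x)
      then have x: "x \<in> \<Omega>" by simp
      have "(\<lambda>n. min (z n x) T powr r x) \<longlonglongrightarrow> 0"
      proof (rule tendsto_zero_powrI[OF _ tendsto_const])
        show "(\<lambda>n. min (z n x) T) \<longlonglongrightarrow> 0"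
          using tendsto_min[OF elim(1) tendsto_const[of T]] T by simp
      qed (use r(2)[OF x] z0 T in auto)
      from tendsto_ennrealI[OF this] show ?case by simp
    qed
  qed measurable
  then have "eventually (\<lambda>n. (\<integral>\<^sup>+x. ennreal (min (z n x) T powr r x) \<partial>leb) < ennreal (\<epsilon> / 2)) sequentially"
    using \<epsilon> by (intro order_tendstoD(2)) auto
  then show ?thesis
  proof eventually_elim
    case (elim n)
    have "(\<integral>\<^sup>+x. ennreal (z n x powr r x) \<partial>leb) \<le> (\<integral>\<^sup>+x. ennreal (min (z n x) T powr r x)
        + ennreal (T powr (- \<delta>)) * ennreal (z n x powr (r x + \<delta>)) \<partial>leb)"
    proof (intro nn_integral_mono)
      fix x assume "x \<in> space leb"
      then have "0 \<le> r x" using r(2)[of x] by simp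
      then have "z n x powr r x \<le> min (z n x) T powr r x + T powr (- \<delta>) * z n x powr (r x + \<delta>)"
        using z0 T \<delta> by (intro powr_le_cutoff_plus) auto
      from ennreal_leI[OF this] show "ennreal (z n x powr r x) \<le> ennreal (min (z n x) T powr r x)
        + ennreal (T powr (- \<delta>)) * ennreal (z n x powr (r x + \<delta>))"
        by (simp add: ennreal_mult)
    qed
    also have "\<dots> = (\<integral>\<^sup>+x. ennreal (min (z n x) T powr r x) \<partial>leb)
        + ennreal (T powr (- \<delta>)) * (\<integral>\<^sup>+x. ennreal (z n x powr (r x + \<delta>)) \<partial>leb)"
      by (simp add: nn_integral_add nn_integral_cmult)
    also have "\<dots> \<le> (\<integral>\<^sup>+x. ennreal (min (z n x) T powr r x) \<partial>leb) + ennreal (T powr (- \<delta>)) * ennreal C"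
      using C by (intro add_left_mono mult_left_mono) auto
    also have "\<dots> \<le> (\<integral>\<^sup>+x. ennreal (min (z n x) T powr r x) \<partial>leb) + ennreal (\<epsilon> / 2)"
      using TC C by (intro add_left_mono) (simp add: ennreal_mult[symmetric] ennreal_leI)
    also have "\<dots> = ennreal (\<epsilon> / 2) + (\<integral>\<^sup>+x. ennreal (min (z n x) T powr r x) \<partial>leb)"
      by (rule add.commute)
    also have "\<dots> < ennreal (\<epsilon> / 2) + ennreal (\<epsilon> / 2)"
      using elim by (simp only: ennreal_add_left_cancel_less) simp
    also have "\<dots> = ennreal \<epsilon>" using \<epsilon> by (simp flip: ennreal_plus)
    finally show ?case .
  qed
qed

lemma luxemburg_norm_eventually_le:
  assumes z: "\<And>n. z n \<in> borel_measurable leb"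
    and r: "continuous_on (closure \<Omega>) r" "\<And>x. x \<in> \<Omega> \<Longrightarrow> 1 \<le> r x \<and> r x \<le> R"
    and small: "\<And>\<epsilon>. 0 < \<epsilon> \<Longrightarrow>
      eventually (\<lambda>n. (\<integral>\<^sup>+x. ennreal (\<bar>z n x\<bar> powr r x) \<partial>leb) < ennreal \<epsilon>) sequentially"
    and \<epsilon>: "0 < \<epsilon>"
  shows "eventually (\<lambda>n. luxemburg_norm \<Omega> r (z n) \<le> \<epsilon>) sequentially"
proof -
  define l where "l = max 1 (1 / \<epsilon>)"
  have l: "1 \<le> l" "1 / \<epsilon> \<le> l" by (auto simp: l_def)
  have "eventually (\<lambda>n. (\<integral>\<^sup>+x. ennreal (\<bar>z n x\<bar> powr r x) \<partial>leb) < ennreal (1 / l powr R)) sequentially"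
    using l by (intro small) auto
  then show ?thesis
  proof eventually_elim
    case (elim n)
    have "(\<integral>\<^sup>+x. ennreal (\<bar>z n x / \<epsilon>\<bar> powr r x) \<partial>leb)
        \<le> ennreal (l powr R) * (\<integral>\<^sup>+x. ennreal (\<bar>z n x\<bar> powr r x) \<partial>leb)"
    proof (intro nn_integral_le_cmult power_measurable z r(1))
      fix x assume x: "x \<in> \<Omega>"
      have "\<bar>z n x / \<epsilon>\<bar> = 1 / \<epsilon> * \<bar>z n x\<bar>" using \<epsilon> by simp
      also have "\<dots> \<le> l * \<bar>z n x\<bar>" using l by (intro mult_right_mono) auto
      finally have "\<bar>z n x / \<epsilon>\<bar> \<le> \<bar>l * z n x\<bar>" using l by (simp add: abs_mult)
      then have "\<bar>z n x / \<epsilon>\<bar> powr r x \<le> \<bar>l * z n x\<bar> powr r x"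
        using r(2)[OF x] by (intro powr_mono2) auto
      also have "\<dots> \<le> l powr R * \<bar>z n x\<bar> powr r x"
        using r(2)[OF x] l by (intro dilated_powr_le) auto
      finally show "\<bar>z n x / \<epsilon>\<bar> powr r x \<le> l powr R * \<bar>z n x\<bar> powr r x" .
    qed auto
    also have "\<dots> \<le> ennreal (l powr R) * ennreal (1 / l powr R)"
      using elim by (intro mult_left_mono) auto
    also have "\<dots> = 1" using l by (simp add: ennreal_mult[symmetric])
    finally show ?case by (rule luxemburg_norm_le[OF \<epsilon>])
  qed
qed

lemma lebesgue_space_of_higher_power:
  assumes u: "u \<in> borel_measurable leb" and r: "continuous_on (closure \<Omega>) r" "\<And>x. x \<in> \<Omega> \<Longrightarrow> 1 \<le> r x"
    and \<delta>: "0 < \<delta>" and C: "0 \<le> C" "(\<integral>\<^sup>+x. ennreal (\<bar>u x\<bar> powr (r x + \<delta>)) \<partial>leb) \<le> ennreal C"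
  shows "(\<integral>\<^sup>+x. ennreal (\<bar>u x\<bar> powr r x) \<partial>leb) \<le> ennreal (measure leb \<Omega> + C)"
    and "u \<in> lebesgue_space \<Omega> r"
proof -
  have [measurable]: "u \<in> borel_measurable leb" "r \<in> borel_measurable leb"
    using u continuous_imp_measurable[OF r(1)] by auto
  have "(\<integral>\<^sup>+x. ennreal (\<bar>u x\<bar> powr r x) \<partial>leb) \<le> ennreal (measure leb \<Omega> + max 0 C)"
  proof (rule nn_integral_le_of_le_one_plus[OF _ C(2)])
    fix x assume "x \<in> \<Omega>"
    then have "\<bar>u x\<bar> powr r x \<le> 1 + \<bar>u x\<bar> powr (r x + \<delta>)"
      using r(2)[of x] \<delta> by (intro powr_le_one_plus) auto
    from ennreal_leI[OF this]
    show "ennreal (\<bar>u x\<bar> powr r x) \<le> 1 + ennreal (\<bar>u x\<bar> powr (r x + \<delta>))" by simp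
  qed measurable
  then show le: "(\<integral>\<^sup>+x. ennreal (\<bar>u x\<bar> powr r x) \<partial>leb) \<le> ennreal (measure leb \<Omega> + C)"
    using C by (simp add: max_def)
  show "u \<in> lebesgue_space \<Omega> r"
    using u le_less_trans[OF le ennreal_less_top] by (simp add: lebesgue_space_def)
qed

section \<open>The compact embedding\<close>

text \<open>Scaling \<open>w\<close> by its norm bound puts it into \<open>modular_ball 1\<close>, where the modular with exponent \<open>r\<close> is at most \<open>A\<close>.
  As \<open>r \<ge> 1\<close>, multiplication by \<open>\<theta> \<le> 1\<close> shrinks that modular at least by the factor \<open>\<theta>\<close>, and
  \<open>\<theta> = 1 / (A + 1)\<close> brings it below 1.\<close>

lemma embedding_continuous_at:
  assumes r: "continuous_on (closure \<Omega>) r" "\<And>x. x \<in> \<Omega> \<Longrightarrow> 1 \<le> r x"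
    and \<delta>: "0 < \<delta>" and C: "0 \<le> C"
      "\<And>u. u \<in> modular_ball 1 \<Longrightarrow> (\<integral>\<^sup>+x. ennreal (\<bar>u x\<bar> powr (r x + \<delta>)) \<partial>leb) \<le> ennreal C"
    and \<epsilon>: "0 < \<epsilon>"
  shows "\<exists>d>0. \<forall>w\<in>fractional_sobolev_space \<Omega> s q p.
    fractional_sobolev_norm \<Omega> s q p w < d \<longrightarrow> luxemburg_norm \<Omega> r w < \<epsilon>"
proof -
  define A where "A = measure leb \<Omega> + C"
  have A: "0 \<le> A" using C by (simp add: A_def)
  define \<theta> where "\<theta> = 1 / (A + 1)"
  have \<theta>: "0 < \<theta>" "\<theta> \<le> 1" "\<theta> * A \<le> 1" using A by (auto simp: \<theta>_def field_simps)
  show ?thesis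
  proof (intro exI[of _ "\<theta> * (\<epsilon> / 2)"] conjI ballI impI)
    fix w assume w: "w \<in> fractional_sobolev_space \<Omega> s q p"
      and less: "fractional_sobolev_norm \<Omega> s q p w < \<theta> * (\<epsilon> / 2)"
    define v where "v = (\<lambda>x. w x / (\<theta> * (\<epsilon> / 2)))"
    have v: "v \<in> modular_ball 1"
      unfolding v_def by (rule fractional_sobolev_norm_lessD[OF w less])
    then have vm: "v \<in> borel_measurable leb" by (simp add: modular_ball_def)
    have "w x / (\<epsilon> / 2) = \<theta> * v x" for x using \<theta> \<epsilon> by (simp add: v_def)
    then have "(\<integral>\<^sup>+x. ennreal (\<bar>w x / (\<epsilon> / 2)\<bar> powr r x) \<partial>leb)
        = (\<integral>\<^sup>+x. ennreal (\<bar>\<theta> * v x\<bar> powr r x) \<partial>leb)" by presburger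
    also have "\<dots> \<le> ennreal \<theta> * (\<integral>\<^sup>+x. ennreal (\<bar>v x\<bar> powr r x) \<partial>leb)"
      using \<theta> r by (intro nn_integral_le_cmult power_measurable vm scaled_powr_le) auto
    also have "\<dots> \<le> ennreal \<theta> * ennreal A"
      unfolding A_def
      by (intro mult_left_mono lebesgue_space_of_higher_power(1)[OF vm r \<delta> C(1) C(2)[OF v]]) auto
    also have "\<dots> \<le> 1" using \<theta> A by (simp add: ennreal_mult[symmetric])
    finally have "luxemburg_norm \<Omega> r w \<le> \<epsilon> / 2" using \<epsilon> by (intro luxemburg_norm_le) auto
    then show "luxemburg_norm \<Omega> r w < \<epsilon>" using \<epsilon> by simp
  qed (use \<theta> \<epsilon> in simp)
qed

text \<open>The limit inherits the bound of order \<open>r + \<delta>\<close> by Fatou's lemma, so the differences are bounded in the same way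
  and the Vitali argument applies to them.\<close>

lemma modular_ball_convergent_subsequence:
  assumes f: "\<And>n. f n \<in> modular_ball K"
    and r: "continuous_on (closure \<Omega>) r" "\<And>x. x \<in> \<Omega> \<Longrightarrow> 1 \<le> r x \<and> r x \<le> R"
    and \<delta>: "0 < \<delta>" and C: "0 \<le> C"
      "\<And>u. u \<in> modular_ball K \<Longrightarrow> (\<integral>\<^sup>+x. ennreal (\<bar>u x\<bar> powr (r x + \<delta>)) \<partial>leb) \<le> ennreal C"
  obtains k :: "nat \<Rightarrow> nat" and w where "strict_mono k" "w \<in> lebesgue_space \<Omega> r"
    "(\<lambda>n. luxemburg_norm \<Omega> r (\<lambda>x. f (k n) x - w x)) \<longlonglongrightarrow> 0"
proof -
  obtain k :: "nat \<Rightarrow> nat" where k: "strict_mono k" and cau: "AE x in leb. Cauchy (\<lambda>n. f (k n) x)"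
    by (rule modular_ball_AE_Cauchy_subsequence[OF f])
  define g where "g = (\<lambda>n. f (k n))"
  define w where "w = (\<lambda>x. lim (\<lambda>n. g n x))"
  have gK: "g n \<in> modular_ball K" for n by (simp add: g_def f)
  have gm[measurable]: "g n \<in> borel_measurable leb" for n using gK by (simp add: modular_ball_def)
  have wm[measurable]: "w \<in> borel_measurable leb" unfolding w_def by measurable
  have [measurable]: "r \<in> borel_measurable leb" by (rule continuous_imp_measurable[OF r(1)])
  have lim: "AE x in leb. (\<lambda>n. g n x) \<longlonglongrightarrow> w x"
    using cau
  proof eventually_elim
    case (elim x)
    then have "convergent (\<lambda>n. g n x)" by (simp add: g_def Cauchy_convergent_iff)
    then show ?case by (simp add: w_def convergent_LIMSEQ_iff)
  qed
  have r1: "\<And>x. x \<in> \<Omega> \<Longrightarrow> 1 \<le> r x" using r(2) by auto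
  have rd: "continuous_on (closure \<Omega>) (\<lambda>x. r x + \<delta>)" by (intro continuous_intros r(1))
  have "(\<integral>\<^sup>+x. ennreal (\<bar>w x\<bar> powr (r x + \<delta>)) \<partial>leb)
      \<le> (\<integral>\<^sup>+x. liminf (\<lambda>n. ennreal (\<bar>g n x\<bar> powr (r x + \<delta>))) \<partial>leb)"
  proof (rule nn_integral_mono_AE)
    show "AE x in leb. ennreal (\<bar>w x\<bar> powr (r x + \<delta>)) \<le> liminf (\<lambda>n. ennreal (\<bar>g n x\<bar> powr (r x + \<delta>)))"
      using lim AE_space
    proof eventually_elim
      case (elim x)
      then have "0 < r x + \<delta>" using r1[of x] \<delta> by auto
      then have "(\<lambda>n. \<bar>g n x\<bar> powr (r x + \<delta>)) \<longlonglongrightarrow> \<bar>w x\<bar> powr (r x + \<delta>)"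
        using elim(1) by (intro tendsto_powr' tendsto_rabs tendsto_const) auto
      from tendsto_ennrealI[OF this]
      have "liminf (\<lambda>n. ennreal (\<bar>g n x\<bar> powr (r x + \<delta>))) = ennreal (\<bar>w x\<bar> powr (r x + \<delta>))"
        by (intro lim_imp_Liminf) auto
      then show ?case by simp
    qed
  qed
  also have "\<dots> \<le> liminf (\<lambda>n. \<integral>\<^sup>+x. ennreal (\<bar>g n x\<bar> powr (r x + \<delta>)) \<partial>leb)"
    by (intro nn_integral_liminf) measurable
  also have "\<dots> \<le> ennreal C"
    using C(2)[OF gK] by (intro Liminf_le) auto
  finally have wC: "(\<integral>\<^sup>+x. ennreal (\<bar>w x\<bar> powr (r x + \<delta>)) \<partial>leb) \<le> ennreal C" .
  define z where "z = (\<lambda>n x. \<bar>g n x - w x\<bar>)"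
  have zm: "z n \<in> borel_measurable leb" for n unfolding z_def by measurable
  have zC: "(\<integral>\<^sup>+x. ennreal (z n x powr (r x + \<delta>)) \<partial>leb) \<le> ennreal (2 powr (R + \<delta>) * (2 * C))" for n
    unfolding z_def using r(2) \<delta> C(1)
    by (intro difference_power_bound gm wm rd wC C(2)[OF gK]) force+
  have zlim: "AE x in leb. (\<lambda>n. z n x) \<longlonglongrightarrow> 0"
    using lim by eventually_elim (auto simp: z_def intro!: tendsto_rabs_zero simp: LIM_zero_iff)
  have small: "eventually (\<lambda>n. (\<integral>\<^sup>+x. ennreal (z n x powr r x) \<partial>leb) < ennreal \<epsilon>) sequentially" if "0 < \<epsilon>" for \<epsilon>
    by (rule vitali_modular_convergence[OF zm _ zlim r \<delta> _ zC that]) (use C in \<open>auto simp: z_def\<close>)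
  have small_norm: "eventually (\<lambda>n. luxemburg_norm \<Omega> r (\<lambda>x. g n x - w x) \<le> \<epsilon>) sequentially" if "0 < \<epsilon>" for \<epsilon>
  proof (rule luxemburg_norm_eventually_le[OF _ r _ that])
    show "(\<lambda>x. g n x - w x) \<in> borel_measurable leb" for n by measurable
  qed (use small in \<open>auto simp: z_def\<close>)
  have dL: "(\<lambda>x. g n x - w x) \<in> lebesgue_space \<Omega> r" for n
    by (rule lebesgue_space_of_higher_power(2)[OF _ r(1) r1 \<delta> _ zC[unfolded z_def]]) (use C in auto)
  have "(\<lambda>n. luxemburg_norm \<Omega> r (\<lambda>x. g n x - w x)) \<longlonglongrightarrow> 0"
  proof (rule LIMSEQ_I)
    fix \<epsilon> :: real assume "0 < \<epsilon>"
    then obtain N where "\<And>n. N \<le> n \<Longrightarrow> luxemburg_norm \<Omega> r (\<lambda>x. g n x - w x) \<le> \<epsilon> / 2"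
      using small_norm[of "\<epsilon> / 2"] by (auto simp: eventually_sequentially)
    moreover have "0 \<le> luxemburg_norm \<Omega> r (\<lambda>x. g n x - w x)" for n
      by (rule luxemburg_norm_nonneg[OF dL r(1) r1])
    ultimately show "\<exists>N. \<forall>n\<ge>N. norm (luxemburg_norm \<Omega> r (\<lambda>x. g n x - w x) - 0) < \<epsilon>"
      using \<open>0 < \<epsilon>\<close> by (intro exI[of _ N]) (force simp: abs_of_nonneg)
  qed
  moreover have "w \<in> lebesgue_space \<Omega> r"
    by (rule lebesgue_space_of_higher_power(2)[OF wm r(1) r1 \<delta> C(1) wC])
  ultimately show ?thesis using that k by (simp add: g_def)
qed

lemma compact_embedding:
  assumes lip: "lipschitz_domain \<Omega>" and sP: "s * P < real DIM('a)"
    and r: "continuous_on (closure \<Omega>) r" "\<And>x. x \<in> closure \<Omega> \<Longrightarrow> 1 < r x \<and> r x \<le> R"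
    and r_less: "\<And>x. x \<in> closure \<Omega> \<Longrightarrow>
      r x < real DIM('a) * p (x, x) / (real DIM('a) - s * p (x, x))"
  shows "compactly_imbedded
           (fractional_sobolev_space \<Omega> s q p) (fractional_sobolev_norm \<Omega> s q p)
           (lebesgue_space \<Omega> r) (luxemburg_norm \<Omega> r)"
proof -
  let ?W = "fractional_sobolev_space \<Omega> s q p"
  have r1: "1 \<le> r x" and r2: "1 \<le> r x \<and> r x \<le> R" if "x \<in> \<Omega>" for x
    using r(2)[OF in_closure[OF that]] by auto
  obtain \<delta> where \<delta>: "0 < \<delta>" and *: "\<And>K. \<exists>C\<ge>0. \<forall>u\<in>modular_ball K.
     (\<integral>\<^sup>+x. ennreal (\<bar>u x\<bar> powr (r x + \<delta>)) \<partial>leb) \<le> ennreal C"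
    by (rule higher_integrability[OF lip sP r(1) _ r_less]) (use r(2) in auto)
  have sub: "?W \<subseteq> lebesgue_space \<Omega> r"
  proof
    fix u assume "u \<in> ?W"
    then obtain K where K: "u \<in> modular_ball K" by (auto simp: fractional_sobolev_space_iff)
    then have um: "u \<in> borel_measurable leb" by (simp add: modular_ball_def)
    obtain C where C: "0 \<le> C" "(\<integral>\<^sup>+x. ennreal (\<bar>u x\<bar> powr (r x + \<delta>)) \<partial>leb) \<le> ennreal C"
      using *[of K] K by blast
    show "u \<in> lebesgue_space \<Omega> r" by (rule lebesgue_space_of_higher_power(2)[OF um r(1) r1 \<delta> C])
  qed
  have cont: "\<exists>d>0. \<forall>v\<in>?W. fractional_sobolev_norm \<Omega> s q p (\<lambda>x. v x - u x) < d \<longrightarrow>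
      luxemburg_norm \<Omega> r (\<lambda>x. v x - u x) < \<epsilon>" if u: "u \<in> ?W" and "0 < \<epsilon>" for u \<epsilon>
  proof -
    obtain C where C: "0 \<le> C" "\<And>u. u \<in> modular_ball 1 \<Longrightarrow>
        (\<integral>\<^sup>+x. ennreal (\<bar>u x\<bar> powr (r x + \<delta>)) \<partial>leb) \<le> ennreal C"
      using *[of 1] by blast
    have "\<exists>d>0. \<forall>w\<in>?W. fractional_sobolev_norm \<Omega> s q p w < d \<longrightarrow> luxemburg_norm \<Omega> r w < \<epsilon>"
      by (rule embedding_continuous_at[OF r(1) r1 \<delta> C \<open>0 < \<epsilon>\<close>])
    then obtain d where "0 < d"
      "\<forall>w\<in>?W. fractional_sobolev_norm \<Omega> s q p w < d \<longrightarrow> luxemburg_norm \<Omega> r w < \<epsilon>"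
      by blast
    then show ?thesis
      using fractional_sobolev_space_diff[OF _ u] by (intro exI[of _ d]) auto
  qed
  have comp: "\<exists>k :: nat \<Rightarrow> nat. \<exists>w\<in>lebesgue_space \<Omega> r. strict_mono k \<and>
      (\<lambda>n. luxemburg_norm \<Omega> r (\<lambda>x. f (k n) x - w x)) \<longlonglongrightarrow> 0"
    if f: "\<And>n :: nat. f n \<in> ?W" and bd: "\<And>n. fractional_sobolev_norm \<Omega> s q p (f n) \<le> B" for f B
  proof -
    obtain K where K: "\<And>n. f n \<in> modular_ball K"
      using bounded_sequence_in_modular_ball[of f B, OF f bd] by blast
    obtain C where C: "0 \<le> C" "\<And>u. u \<in> modular_ball K \<Longrightarrow>
        (\<integral>\<^sup>+x. ennreal (\<bar>u x\<bar> powr (r x + \<delta>)) \<partial>leb) \<le> ennreal C"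
      using *[of K] by blast
    obtain k :: "nat \<Rightarrow> nat" and w where "strict_mono k" "w \<in> lebesgue_space \<Omega> r"
      "(\<lambda>n. luxemburg_norm \<Omega> r (\<lambda>x. f (k n) x - w x)) \<longlonglongrightarrow> 0"
      by (rule modular_ball_convergent_subsequence[OF K r(1) r2 \<delta> C])
    then show ?thesis by blast
  qed
  show ?thesis
    unfolding compactly_imbedded_def compact_linear_operator_def
  proof (intro conjI allI ballI impI)
    show "\<exists>d>0. \<forall>v\<in>?W. fractional_sobolev_norm \<Omega> s q p (\<lambda>x. v x - u x) < d \<longrightarrow>
      luxemburg_norm \<Omega> r (\<lambda>x. v x - u x) < \<epsilon>" if "u \<in> ?W" "0 < \<epsilon>" for u \<epsilon>
      using that by (rule cont)
    show "\<exists>k :: nat \<Rightarrow> nat. \<exists>w\<in>lebesgue_space \<Omega> r. strict_mono k \<and>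
      (\<lambda>n. luxemburg_norm \<Omega> r (\<lambda>x. f (k n) x - w x)) \<longlonglongrightarrow> 0"
      if "(\<forall>n :: nat. f n \<in> ?W) \<and> (\<exists>C. \<forall>n. fractional_sobolev_norm \<Omega> s q p (f n) \<le> C)" for f
      using that comp by blast
  qed (use sub in auto)
qed

end

theorem theorem3p2:
  fixes \<Omega> :: "'a::euclidean_space set"
    and s :: real
    and p :: "'a \<times> 'a \<Rightarrow> real"
    and q r :: "'a \<Rightarrow> real"
  assumes "bounded \<Omega>" and "lipschitz_domain \<Omega>"
    and "0 < s" and "s < 1"
    and "continuous_on (closure \<Omega> \<times> closure \<Omega>) p"
    and "\<And>x y. x \<in> closure \<Omega> \<Longrightarrow> y \<in> closure \<Omega> \<Longrightarrow> p (x, y) = p (y, x)"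
    and "bdd_below (p ` (closure \<Omega> \<times> closure \<Omega>))" and "bdd_above (p ` (closure \<Omega> \<times> closure \<Omega>))"
    and "1 < (INF z\<in>closure \<Omega> \<times> closure \<Omega>. p z)"
    and "q \<in> C_plus (closure \<Omega>)"
    and "s * (SUP z\<in>closure \<Omega> \<times> closure \<Omega>. p z) < real DIM('a)"
    and "\<And>x. x \<in> closure \<Omega> \<Longrightarrow> q x \<ge> p (x, x)"
    and "r \<in> C_plus (closure \<Omega>)"
    and "\<And>x. x \<in> closure \<Omega> \<Longrightarrow>
           r x < real DIM('a) * p (x, x) / (real DIM('a) - s * p (x, x))"
  shows "compactly_imbedded
           (fractional_sobolev_space \<Omega> s q p) (fractional_sobolev_norm \<Omega> s q p)
           (lebesgue_space \<Omega> r) (luxemburg_norm \<Omega> r)"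
proof -
  define P where "P = (SUP z\<in>closure \<Omega> \<times> closure \<Omega>. p z)"
  define \<sigma> where "\<sigma> = (INF x\<in>closure \<Omega>. q x)"
  define Q where "Q = (SUP x\<in>closure \<Omega>. q x)"
  define R where "R = (SUP x\<in>closure \<Omega>. r x)"
  have op: "open \<Omega>" using assms(2) by (simp add: lipschitz_domain_def)
  have p: "1 \<le> p (x, y) \<and> p (x, y) \<le> P" if "x \<in> closure \<Omega>" "y \<in> closure \<Omega>" for x y
    using cINF_lower[OF assms(7), of "(x, y)"] cSUP_upper[OF _ assms(8), of "(x, y)"] assms(9) that
    by (auto simp: P_def)
  have q: "continuous_on (closure \<Omega>) q" "1 < \<sigma>"
    and q_bounds: "\<And>x. x \<in> closure \<Omega> \<Longrightarrow> \<sigma> \<le> q x \<and> q x \<le> Q"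
    using assms(10) by (auto simp: C_plus_def \<sigma>_def Q_def intro: cINF_lower cSUP_upper)
  have r: "continuous_on (closure \<Omega>) r"
    and r_bounds: "\<And>x. x \<in> closure \<Omega> \<Longrightarrow> 1 < r x \<and> r x \<le> R"
    using assms(13) by (auto simp: C_plus_def R_def intro: cSUP_upper less_le_trans[OF _ cINF_lower])
  interpret fractional_setting \<Omega> s p P q \<sigma> Q
    by unfold_locales (use assms(1,3,5) op p q q_bounds in auto)
  show ?thesis
    using compact_embedding[OF assms(2) _ r r_bounds assms(14)] assms(11) by (simp add: P_def)
qed

end
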